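(* Assume $0<T<T_0$. Let $h\in\mathcal X$ be the fixed point of the Feynman--Kac mapping, $h=\mathcal L_h$, and define $h_0=0$ and $h_n=\mathcal L_{h_{n-1}}$ for $n\ge1$. Then for any $0<\delta<1/2$, $$\|h-h_n\|\le O(n^{-\delta n})\qquad\text{as } n\to\infty,$$ where $\|f\|=\sup_{s\in\mathbb R,\ 0\le t\le T}\big(|f(s,t)|+|f_s(s,t)|\big)$.
   Context: Parameters. Fix constants $0<\gamma<1$, $\kappa>0$, $\sigma>0$, $\varpi>0$, $T>0$ and $r\in\mathbb R$ with $r\le\kappa$ and $\kappa_1:=\kappa+r>0$. Put $\gamma_1=\frac{\sigma^2}{1-\gamma}$, $\gamma_2=\frac{\gamma\kappa_1}{1-\gamma}+\kappa$, $\gamma_3=\frac{\gamma\kappa_1^2}{(1-\gamma)\sigma^2}$, $\check\gamma_2=\gamma_2/\gamma_1$, $\check\gamma_3=\gamma_3/\gamma_1$, $\vartheta=\sqrt{\check\gamma_2^2-\check\gamma_3}$, $\omega=2\vartheta\gamma_1$, and $$g(t)=\check\gamma_2-\vartheta-\frac{2\vartheta(\check\gamma_2-\vartheta)}{e^{\omega(T-t)}(\check\gamma_2+\vartheta)-\check\gamma_2+\vartheta},\qquad 0\le t\le T,$$ which solves $g'(t)-2\gamma_2g(t)+\gamma_1g^2(t)+\gamma_3=0$, $g(T)=0$. Put $g_1(t)=\gamma_1g(t)-\gamma_2$, $$\mathbf B_1=\frac1{\gamma_1}\left(\sqrt{\frac{\pi}{2T}}+\sqrt{\frac{|\pi-4T\sigma^2\varpi^{1/(\gamma-1)}|}{2T}}\right),\qquad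 \mathbf B_0=\Big(q_1+\frac{\gamma_1}{2}\mathbf B_1^2\Big)T,\qquad q_1=\frac{g(0)\sigma^2}{2}+r\gamma+(1-\gamma)\varpi^{1/(\gamma-1)},$$ $$T_0=\min\left(\frac{\kappa(1-\gamma)}{2(3+\gamma)\kappa_2},\ \frac{\gamma(1-\gamma)}{(3+\gamma)(\gamma+1)\sigma^2g(0)},\ \frac{\pi}{4\sigma^2}\right),\qquad \kappa_2=\kappa_1^2\Big(\frac1{\sigma^2}+\frac12+\frac{g(0)}{\kappa_1}\Big).$$ Function space. $\mathcal X$ is the set of functions $h:\mathbb R\times[0,T]\to\mathbb R_+=[0,\infty)$, $(s,t)\mapsto h(s,t)$, of class $C^{1,0}$ ($h$ and $h_s=\partial h/\partial s$ are continuous on $\mathbb R\times[0,T]$), with $\sup_{s,t}h(s,t)\le\mathbf B_0$ and $\sup_{s,t}|h_s(s,t)|\le\mathbf B_1$. Feynman--Kac mapping. For $0\le t\le T$, $s\in\mathbb R$ let $(\eta^{s,t}_u)_{t\le u\le T}$ solve $d\eta^{s,t}_u=g_1(u)\eta^{s,t}_u\,du+\sigma\,d\check W_u$, $\eta^{s,t}_t=s$, where $\check W$ is a standard Brownian motion. For $h\in\mathcal X$ set $$\mathcal L_h(s,t)=\int_t^T\mathbf E\,\Psi_h(\eta^{s,t}_u,u)\,du,$$ $$\Psi_h(s,t)=\frac{\sigma^2h_s(s,t)^2}{2(1-\gamma)}+\frac{\sigma^2g(t)}2+r\gamma+(1-\gamma)\varpi^{-1/(1-\gamma)}G(s,t,h(s,t)),\qquad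 G(s,t,y)=\exp\Big\{-\frac1{1-\gamma}\Big(\frac{s^2}2g(t)+y\Big)\Big\}.$$
   Formalization: The formal statement additionally assumes that every iterate h_n lies in the space X, on which the Feynman–Kac mapping is defined; for small ϖ the first iterate can violate the bound on its s-derivative, and the recursion is then undefined. *)

theory Defs
  imports "HOL-Probability.Probability"
begin

text \<open>
  Each constant takes those of the parameters \<open>\<gamma> \<kappa> r \<sigma> varpi T\<close> it depends on, in this order.
\<close>

definition kappa1 :: "real \<Rightarrow> real \<Rightarrow> real" where
  "kappa1 \<kappa> r = \<kappa> + r"

definition gamma1 :: "real \<Rightarrow> real \<Rightarrow> real" where
  "gamma1 \<gamma> \<sigma> = \<sigma>\<^sup>2 / (1 - \<gamma>)"

definition gamma2 :: "real \<Rightarrow> real \<Rightarrow> real \<Rightarrow> real" where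
  "gamma2 \<gamma> \<kappa> r = \<gamma> * kappa1 \<kappa> r / (1 - \<gamma>) + \<kappa>"

definition gamma3 :: "real \<Rightarrow> real \<Rightarrow> real \<Rightarrow> real \<Rightarrow> real" where
  "gamma3 \<gamma> \<kappa> r \<sigma> = \<gamma> * (kappa1 \<kappa> r)\<^sup>2 / ((1 - \<gamma>) * \<sigma>\<^sup>2)"

definition gamma2_check :: "real \<Rightarrow> real \<Rightarrow> real \<Rightarrow> real \<Rightarrow> real" where
  "gamma2_check \<gamma> \<kappa> r \<sigma> = gamma2 \<gamma> \<kappa> r / gamma1 \<gamma> \<sigma>"

definition gamma3_check :: "real \<Rightarrow> real \<Rightarrow> real \<Rightarrow> real \<Rightarrow> real" where
  "gamma3_check \<gamma> \<kappa> r \<sigma> = gamma3 \<gamma> \<kappa> r \<sigma> / gamma1 \<gamma> \<sigma>"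

definition vartheta :: "real \<Rightarrow> real \<Rightarrow> real \<Rightarrow> real \<Rightarrow> real" where
  "vartheta \<gamma> \<kappa> r \<sigma> = sqrt ((gamma2_check \<gamma> \<kappa> r \<sigma>)\<^sup>2 - gamma3_check \<gamma> \<kappa> r \<sigma>)"

definition omega :: "real \<Rightarrow> real \<Rightarrow> real \<Rightarrow> real \<Rightarrow> real" where
  "omega \<gamma> \<kappa> r \<sigma> = 2 * vartheta \<gamma> \<kappa> r \<sigma> * gamma1 \<gamma> \<sigma>"

definition g_fun :: "real \<Rightarrow> real \<Rightarrow> real \<Rightarrow> real \<Rightarrow> real \<Rightarrow> real \<Rightarrow> real" where
  "g_fun \<gamma> \<kappa> r \<sigma> T t =
     (let c = gamma2_check \<gamma> \<kappa> r \<sigma>; v = vartheta \<gamma> \<kappa> r \<sigma> in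
      c - v - 2 * v * (c - v) / (exp (omega \<gamma> \<kappa> r \<sigma> * (T - t)) * (c + v) - c + v))"

definition g1_fun :: "real \<Rightarrow> real \<Rightarrow> real \<Rightarrow> real \<Rightarrow> real \<Rightarrow> real \<Rightarrow> real" where
  "g1_fun \<gamma> \<kappa> r \<sigma> T t = gamma1 \<gamma> \<sigma> * g_fun \<gamma> \<kappa> r \<sigma> T t - gamma2 \<gamma> \<kappa> r"

definition B1_const :: "real \<Rightarrow> real \<Rightarrow> real \<Rightarrow> real \<Rightarrow> real" where
  "B1_const \<gamma> \<sigma> varpi T =
     1 / gamma1 \<gamma> \<sigma> *
       (sqrt (pi / (2 * T)) + sqrt (\<bar>pi - 4 * T * \<sigma>\<^sup>2 * varpi powr (1 / (\<gamma> - 1))\<bar> / (2 * T)))"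

definition q1_const :: "real \<Rightarrow> real \<Rightarrow> real \<Rightarrow> real \<Rightarrow> real \<Rightarrow> real \<Rightarrow> real" where
  "q1_const \<gamma> \<kappa> r \<sigma> varpi T =
     g_fun \<gamma> \<kappa> r \<sigma> T 0 * \<sigma>\<^sup>2 / 2 + r * \<gamma> + (1 - \<gamma>) * varpi powr (1 / (\<gamma> - 1))"

definition B0_const :: "real \<Rightarrow> real \<Rightarrow> real \<Rightarrow> real \<Rightarrow> real \<Rightarrow> real \<Rightarrow> real" where
  "B0_const \<gamma> \<kappa> r \<sigma> varpi T =
     (q1_const \<gamma> \<kappa> r \<sigma> varpi T + gamma1 \<gamma> \<sigma> / 2 * (B1_const \<gamma> \<sigma> varpi T)\<^sup>2) * T"

definition kappa2 :: "real \<Rightarrow> real \<Rightarrow> real \<Rightarrow> real \<Rightarrow> real \<Rightarrow> real" where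
  "kappa2 \<gamma> \<kappa> r \<sigma> T =
     (kappa1 \<kappa> r)\<^sup>2 * (1 / \<sigma>\<^sup>2 + 1 / 2 + g_fun \<gamma> \<kappa> r \<sigma> T 0 / kappa1 \<kappa> r)"

text \<open>
  \<open>T\<^sub>0\<close> depends on \<open>T\<close> through \<open>g(0)\<close>, so \<open>T < T\<^sub>0\<close> is an implicit smallness condition on \<open>T\<close>.
\<close>

definition T0_const :: "real \<Rightarrow> real \<Rightarrow> real \<Rightarrow> real \<Rightarrow> real \<Rightarrow> real" where
  "T0_const \<gamma> \<kappa> r \<sigma> T =
     Min {\<kappa> * (1 - \<gamma>) / (2 * (3 + \<gamma>) * kappa2 \<gamma> \<kappa> r \<sigma> T),
          \<gamma> * (1 - \<gamma>) / ((3 + \<gamma>) * (\<gamma> + 1) * \<sigma>\<^sup>2 * g_fun \<gamma> \<kappa> r \<sigma> T 0),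
          pi / (4 * \<sigma>\<^sup>2)}"

text \<open>
  A function on \<open>\<real> \<times> [0,T]\<close> is represented by a total curried function of \<open>s\<close> and \<open>t\<close>; only its
  values for \<open>t \<in> {0..T}\<close> matter in what follows.
\<close>

definition ds :: "(real \<Rightarrow> real \<Rightarrow> real) \<Rightarrow> real \<Rightarrow> real \<Rightarrow> real" where
  "ds f s t = deriv (\<lambda>x. f x t) s"

definition fk_space :: "real \<Rightarrow> real \<Rightarrow> real \<Rightarrow> real \<Rightarrow> real \<Rightarrow> real \<Rightarrow> (real \<Rightarrow> real \<Rightarrow> real) set" where
  "fk_space \<gamma> \<kappa> r \<sigma> varpi T =
     {h. continuous_on (UNIV \<times> {0..T}) (\<lambda>(s, t). h s t) \<and>
         (\<forall>s. \<forall>t\<in>{0..T}. (\<lambda>x. h x t) differentiable (at s)) \<and>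
         continuous_on (UNIV \<times> {0..T}) (\<lambda>(s, t). ds h s t) \<and>
         (\<forall>s. \<forall>t\<in>{0..T}. 0 \<le> h s t \<and> h s t \<le> B0_const \<gamma> \<kappa> r \<sigma> varpi T \<and>
                          \<bar>ds h s t\<bar> \<le> B1_const \<gamma> \<sigma> varpi T)}"

text \<open>
  The supremum is taken in the type \<open>real\<close>, hence meaningful for functions that are bounded
  together with their \<open>s\<close>-derivative on the strip, such as differences of members of \<open>fk_space\<close>.
\<close>

definition strip_norm :: "real \<Rightarrow> (real \<Rightarrow> real \<Rightarrow> real) \<Rightarrow> real" where
  "strip_norm T f = (SUP (s, t) \<in> UNIV \<times> {0..T}. \<bar>f s t\<bar> + \<bar>ds f s t\<bar>)"

definition brownian_motion :: "'a measure \<Rightarrow> (real \<Rightarrow> 'a \<Rightarrow> real) \<Rightarrow> bool" where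
  "brownian_motion M W \<longleftrightarrow>
     prob_space M \<and>
     (\<forall>t\<ge>0. W t \<in> borel_measurable M) \<and>
     (AE x in M. W 0 x = 0) \<and>
     (AE x in M. continuous_on {0..} (\<lambda>t. W t x)) \<and>
     (\<forall>s t. 0 \<le> s \<and> s < t \<longrightarrow>
        distributed M lborel (\<lambda>x. W t x - W s x) (normal_density 0 (sqrt (t - s)))) \<and>
     (\<forall>(n::nat) \<tau>. 0 \<le> \<tau> 0 \<and> (\<forall>i<n. \<tau> i \<le> \<tau> (Suc i)) \<longrightarrow>
        prob_space.indep_vars M (\<lambda>_. borel) (\<lambda>i x. W (\<tau> (Suc i)) x - W (\<tau> i) x) {..<n})"

text \<open>
  \<open>\<eta> s t u\<close> is the value at time \<open>u\<close> of the process started in \<open>s\<close> at time \<open>t\<close>.  The noise is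
  additive, so the equation \<open>d\<eta>\<^sub>u = a(u) \<eta>\<^sub>u du + \<sigma> dW\<^sub>u\<close> is a pathwise integral equation and no
  stochastic integral is involved.  Its continuous solution is pathwise unique and is a functional
  of the increments of \<open>W\<close> after \<open>t\<close>; adaptedness is therefore not required separately.
\<close>

definition linear_sde_flow ::
    "'a measure \<Rightarrow> (real \<Rightarrow> 'a \<Rightarrow> real) \<Rightarrow> (real \<Rightarrow> real) \<Rightarrow> real \<Rightarrow> real \<Rightarrow>
     (real \<Rightarrow> real \<Rightarrow> real \<Rightarrow> 'a \<Rightarrow> real) \<Rightarrow> bool" where
  "linear_sde_flow M W a \<sigma> T \<eta> \<longleftrightarrow>
     (\<forall>s. \<forall>t\<in>{0..T}.
        (\<forall>u\<in>{t..T}. \<eta> s t u \<in> borel_measurable M) \<and>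
        (AE x in M. continuous_on {t..T} (\<lambda>u. \<eta> s t u x) \<and>
           (\<forall>u\<in>{t..T}. \<eta> s t u x =
              s + integral {t..u} (\<lambda>v. a v * \<eta> s t v x) + \<sigma> * (W u x - W t x))))"

definition G_fun ::
    "real \<Rightarrow> real \<Rightarrow> real \<Rightarrow> real \<Rightarrow> real \<Rightarrow> real \<Rightarrow> real \<Rightarrow> real \<Rightarrow> real" where
  "G_fun \<gamma> \<kappa> r \<sigma> T s t y =
     exp (- (1 / (1 - \<gamma>)) * (s\<^sup>2 / 2 * g_fun \<gamma> \<kappa> r \<sigma> T t + y))"

definition Psi ::
    "real \<Rightarrow> real \<Rightarrow> real \<Rightarrow> real \<Rightarrow> real \<Rightarrow> real \<Rightarrow>
     (real \<Rightarrow> real \<Rightarrow> real) \<Rightarrow> real \<Rightarrow> real \<Rightarrow> real" where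
  "Psi \<gamma> \<kappa> r \<sigma> varpi T h s t =
     \<sigma>\<^sup>2 * (ds h s t)\<^sup>2 / (2 * (1 - \<gamma>)) + \<sigma>\<^sup>2 * g_fun \<gamma> \<kappa> r \<sigma> T t / 2 + r * \<gamma> +
     (1 - \<gamma>) * varpi powr (- (1 / (1 - \<gamma>))) * G_fun \<gamma> \<kappa> r \<sigma> T s t (h s t)"

text \<open>
  The mapping is only meant for arguments in \<open>fk_space\<close>: there the integrands are bounded and
  continuous, whereas outside \<open>deriv\<close> and the integrals may take arbitrary default values.
  Iterating it therefore presupposes that the iterates stay in \<open>fk_space\<close>; this is not automatic
  for all parameters (for small \<open>varpi\<close> the image of \<open>0\<close> violates the bound on the derivative).
\<close>

definition FK_map ::
    "real \<Rightarrow> real \<Rightarrow> real \<Rightarrow> real \<Rightarrow> real \<Rightarrow> real \<Rightarrow>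
     'a measure \<Rightarrow> (real \<Rightarrow> real \<Rightarrow> real \<Rightarrow> 'a \<Rightarrow> real) \<Rightarrow>
     (real \<Rightarrow> real \<Rightarrow> real) \<Rightarrow> real \<Rightarrow> real \<Rightarrow> real" where
  "FK_map \<gamma> \<kappa> r \<sigma> varpi T M \<eta> h s t =
     integral {t..T} (\<lambda>u. prob_space.expectation M (\<lambda>x. Psi \<gamma> \<kappa> r \<sigma> varpi T h (\<eta> s t u x) u))"

end

theory Submission
  imports Defs "HOL-Real_Asymp.Real_Asymp"
begin

text \<open>
  The mapping gains regularity in \<open>s\<close> because its integrand is averaged over the law of the linear
  diffusion \<open>\<eta>\<close>, which is Gaussian with a standard deviation of order \<open>sqrt (u - t)\<close>.  Moving the
  starting point by \<open>x\<close> therefore moves this law by at most \<open>C * \<bar>x\<bar> / sqrt (u - t)\<close> in total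
  variation, so the \<open>s\<close>-derivative of \<open>FK_map h - FK_map k\<close> is controlled by the mere size of
  \<open>Psi h - Psi k\<close> (\<open>flow_gradient_bound\<close>).  On \<open>fk_space\<close> this size is at most a constant times
  \<open>\<bar>h - k\<bar> + \<bar>ds h - ds k\<bar>\<close> (\<open>Psi_lipschitz\<close>).

  The distance between the fixed point and the iterates thus satisfies a Volterra inequality with the
  integrable kernel \<open>1 / sqrt (u - t)\<close>.  Starting from a constant, the \<open>n\<close>-th iterate of such an
  inequality has the form \<open>\<beta>\<^sub>n * sqrt (T - t) ^ n\<close>, where each step multiplies \<open>\<beta>\<^sub>n\<close> by a number of
  order \<open>1 / sqrt (n + 1)\<close> (\<open>weakly_singular_integral_bound\<close>, \<open>FK_map_gain\<close>).  Hence the error is of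
  order \<open>K ^ n / sqrt (fact n)\<close>, and since \<open>fact n \<ge> (n / exp 1) ^ n\<close> this is \<open>n powr (- n / 2)\<close> up to
  a geometric factor, which is absorbed by lowering the exponent to any \<open>\<delta> < 1 / 2\<close>
  (\<open>power_over_sqrt_fact_bigo\<close>).

  The total variation bound does not require the law of \<open>\<eta>\<close> itself.  After multiplication
  by the integrating factor, \<open>\<eta>\<close> is almost surely a limit of Riemann sums of Brownian increments
  (\<open>linear_equation_riemann_sums\<close>).  These sums are centred normal with a standard deviation bounded
  below uniformly in the mesh, so the bound holds for them and survives the limit for continuous
  bounded test functions.
\<close>

section \<open>A weakly singular Volterra integral\<close>

lemma integral_bound_inverse_sqrt:
  fixes F :: "real \<Rightarrow> real"
  assumes "t \<le> m" "F integrable_on {t..m}"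
    and bnd: "\<And>u. t < u \<Longrightarrow> u \<le> m \<Longrightarrow> \<bar>F u\<bar> \<le> c / sqrt (u - t)"
  shows "\<bar>integral {t..m} F\<bar> \<le> 2 * c * sqrt (m - t)"
proof -
  \<comment> \<open>The majorant takes the value \<open>c / sqrt 0 = 0\<close> at \<open>t\<close>.\<close>
  define F0 where "F0 u = (if u = t then 0 else F u)" for u
  have F0: "(F0 has_integral integral {t..m} F) {t..m}"
    by (rule has_integral_spike[OF negligible_sing[of t] _ integrable_integral[OF assms(2)]])
      (simp add: F0_def)
  have "((\<lambda>u. c / sqrt (u - t)) has_integral (2 * c * sqrt (m - t) - 2 * c * sqrt (t - t))) {t..m}"
    using \<open>t \<le> m\<close>
    by (intro fundamental_theorem_of_calculus_interior)
      (auto intro!: continuous_intros derivative_eq_intros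
        simp: has_real_derivative_iff_has_vector_derivative[symmetric] field_simps)
  then have K: "((\<lambda>u. c / sqrt (u - t)) has_integral 2 * c * sqrt (m - t)) {t..m}" by simp
  have "norm (F0 u) \<le> c / sqrt (u - t)" if "u \<in> {t..m}" for u
    using bnd[of u] that by (auto simp: F0_def)
  then have "norm (integral {t..m} F0) \<le> integral {t..m} (\<lambda>u. c / sqrt (u - t))"
    using F0 K by (intro integral_norm_bound_integral) auto
  then show ?thesis using F0 K by (simp add: integral_unique)
qed

lemma integral_bound_sqrt_power:
  fixes F :: "real \<Rightarrow> real"
  assumes "m \<le> T" "F integrable_on {m..T}"
    and bnd: "\<And>u. m \<le> u \<Longrightarrow> u \<le> T \<Longrightarrow> \<bar>F u\<bar> \<le> c * sqrt (T - u) ^ n"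
  shows "\<bar>integral {m..T} F\<bar> \<le> 2 * c / (real n + 2) * sqrt (T - m) ^ (n + 2)"
proof -
  have "((\<lambda>u. c * sqrt (T - u) ^ n) has_integral
      (- (2 * c / (real n + 2) * sqrt (T - T) ^ (n + 2)) - - (2 * c / (real n + 2) * sqrt (T - m) ^ (n + 2)))) {m..T}"
    using \<open>m \<le> T\<close>
  proof (rule fundamental_theorem_of_calculus_interior)
    fix u assume "u \<in> {m<..<T}"
    then have u: "0 < T - u" by simp
    have "((\<lambda>u. sqrt (T - u)) has_real_derivative - (1 / (2 * sqrt (T - u)))) (at u)"
      using u by (auto intro!: derivative_eq_intros simp: field_simps)
    from DERIV_cmult[OF DERIV_power[OF this, of "n + 2"], of "- (2 * c / (real n + 2))"]
    have "((\<lambda>u. - (2 * c / (real n + 2)) * sqrt (T - u) ^ (n + 2)) has_real_derivative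
        c * sqrt (T - u) ^ n) (at u)"
      by (rule DERIV_cong) (use u in \<open>simp add: field_simps\<close>)
    then show "((\<lambda>u. - (2 * c / (real n + 2) * sqrt (T - u) ^ (n + 2))) has_vector_derivative
        c * sqrt (T - u) ^ n) (at u)"
      by (simp add: has_real_derivative_iff_has_vector_derivative)
  qed (auto intro!: continuous_intros)
  then have K: "((\<lambda>u. c * sqrt (T - u) ^ n) has_integral 2 * c / (real n + 2) * sqrt (T - m) ^ (n + 2)) {m..T}"
    by simp
  have "norm (integral {m..T} F) \<le> integral {m..T} (\<lambda>u. c * sqrt (T - u) ^ n)"
    using assms K by (intro integral_norm_bound_integral) auto
  then show ?thesis by (simp only: integral_unique[OF K] real_norm_def)
qed

text \<open>
  With \<open>\<tau> = T - t\<close>, substitution turns the integral of the majorant into \<open>c * \<tau> powr ((n + 1) / 2)\<close>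
  times the Beta value \<open>B(1/2, n/2 + 1)\<close>, which decays like \<open>1 / sqrt n\<close>.  This rate comes
  from the fact that \<open>(T - u) powr (n / 2)\<close> is concentrated on a layer of width about \<open>\<tau> / (n + 1)\<close>
  above \<open>t\<close>.  Cutting the interval there, one bounds the power by its maximum on the lower part and the
  singular kernel by its maximum on the upper part; both parts contribute the same order.
\<close>

lemma weakly_singular_integral_bound:
  fixes F :: "real \<Rightarrow> real"
  assumes "t \<le> T" "0 \<le> c" "F integrable_on {t..T}"
    and bnd: "\<And>u. t < u \<Longrightarrow> u \<le> T \<Longrightarrow> \<bar>F u\<bar> \<le> c * sqrt (T - u) ^ n / sqrt (u - t)"
  shows "\<bar>integral {t..T} F\<bar> \<le> 4 * c / sqrt (real n + 1) * sqrt (T - t) ^ (n + 1)"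
proof (cases "t = T")
  case False
  define \<tau> where "\<tau> = T - t"
  define m where "m = t + \<tau> / (real n + 1)"
  have \<tau>: "\<tau> > 0" using False assms by (simp add: \<tau>_def)
  have m: "t < m" "m \<le> T"
    using \<tau> divide_left_mono[of 1 "real n + 1" \<tau>] by (auto simp: m_def \<tau>_def)
  have "\<bar>integral {t..m} F\<bar> \<le> 2 * (c * sqrt \<tau> ^ n) * sqrt (m - t)"
  proof (rule integral_bound_inverse_sqrt)
    show "F integrable_on {t..m}"
      using assms(3) m by (auto intro: integrable_on_subinterval)
    show "\<bar>F u\<bar> \<le> c * sqrt \<tau> ^ n / sqrt (u - t)" if "t < u" "u \<le> m" for u
    proof -
      have "\<bar>F u\<bar> \<le> c * sqrt (T - u) ^ n / sqrt (u - t)" using bnd that m by simp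
      also have "\<dots> \<le> c * sqrt \<tau> ^ n / sqrt (u - t)"
        using that \<open>0 \<le> c\<close> m by (intro divide_right_mono mult_left_mono power_mono) (auto simp: \<tau>_def)
      finally show ?thesis .
    qed
  qed (use m in auto)
  also have "\<dots> = 2 * c / sqrt (real n + 1) * sqrt \<tau> ^ (n + 1)"
    by (simp add: m_def real_sqrt_divide)
  finally have 1: "\<bar>integral {t..m} F\<bar> \<le> 2 * c / sqrt (real n + 1) * sqrt \<tau> ^ (n + 1)" .
  have "\<bar>integral {m..T} F\<bar> \<le> 2 * (c / sqrt (m - t)) / (real n + 2) * sqrt (T - m) ^ (n + 2)"
  proof (rule integral_bound_sqrt_power)
    show "F integrable_on {m..T}"
      using assms(3) m by (auto intro: integrable_on_subinterval)
    show "\<bar>F u\<bar> \<le> c / sqrt (m - t) * sqrt (T - u) ^ n" if "m \<le> u" "u \<le> T" for u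
    proof -
      have "\<bar>F u\<bar> \<le> c * sqrt (T - u) ^ n / sqrt (u - t)" using bnd that m by simp
      also have "\<dots> \<le> c * sqrt (T - u) ^ n / sqrt (m - t)"
        using that \<open>0 \<le> c\<close> m by (intro divide_left_mono mult_nonneg_nonneg) auto
      finally show ?thesis by simp
    qed
  qed (use m in auto)
  also have "\<dots> \<le> 2 * (c / sqrt (m - t)) / (real n + 2) * sqrt \<tau> ^ (n + 2)"
    using m \<open>0 \<le> c\<close> by (intro mult_left_mono power_mono) (auto simp: \<tau>_def)
  also have "\<dots> = 2 * c * (sqrt (real n + 1) / (real n + 2)) * sqrt \<tau> ^ (n + 1)"
    using \<tau> by (simp add: m_def real_sqrt_divide)
  also have "\<dots> \<le> 2 * c * (1 / sqrt (real n + 1)) * sqrt \<tau> ^ (n + 1)"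
    using \<tau> \<open>0 \<le> c\<close> by (intro mult_left_mono mult_right_mono) (auto simp: field_simps)
  finally have 2: "\<bar>integral {m..T} F\<bar> \<le> 2 * c / sqrt (real n + 1) * sqrt \<tau> ^ (n + 1)" by simp
  have "integral {t..T} F = integral {t..m} F + integral {m..T} F"
    using assms(3) m by (simp add: Henstock_Kurzweil_Integration.integral_combine)
  then have "\<bar>integral {t..T} F\<bar> \<le> \<bar>integral {t..m} F\<bar> + \<bar>integral {m..T} F\<bar>" by linarith
  then show ?thesis using 1 2 by (simp add: \<tau>_def)
qed simp

section \<open>Total variation distance of shifted normal laws\<close>

text \<open>
  With \<open>p\<close> and \<open>q\<close> the two densities, the \<open>\<chi>\<^sup>2\<close>-divergence of the shifted laws is
  \<open>exp (\<rho>\<^sup>2) - 1\<close> for \<open>\<rho> = \<bar>a - b\<bar> / v\<close>, because \<open>q\<^sup>2 / p\<close> is \<open>exp (\<rho>\<^sup>2)\<close> times another normal density.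
  The inequality between arithmetic and geometric means, with weight \<open>\<rho>\<close>, replaces the
  Cauchy-Schwarz step from \<open>\<chi>\<^sup>2\<close> to \<open>L\<^sup>1\<close> by a pointwise bound.
\<close>

lemma normal_density_shift_L1:
  fixes a b v :: real
  assumes "0 < v" "\<bar>a - b\<bar> \<le> v"
  shows "(\<integral>x. \<bar>normal_density a v x - normal_density b v x\<bar> \<partial>lborel) \<le> 2 * (\<bar>a - b\<bar> / v)"
proof (cases "a = b")
  case False
  define \<rho> where "\<rho> = \<bar>a - b\<bar> / v"
  have \<rho>: "0 < \<rho>" "\<rho> \<le> 1" using False assms by (auto simp: \<rho>_def)
  let ?p = "normal_density a v" and ?q = "normal_density b v"
    and ?r = "normal_density (2 * b - a) v"
  have sq: "?q x * ?q x = ?p x * (exp (\<rho>\<^sup>2) * ?r x)" for x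
  proof -
    have e: "- (x - b)\<^sup>2 / (2 * v\<^sup>2) + - (x - b)\<^sup>2 / (2 * v\<^sup>2)
      = - (x - a)\<^sup>2 / (2 * v\<^sup>2) + (\<rho>\<^sup>2 + - (x - (2 * b - a))\<^sup>2 / (2 * v\<^sup>2))"
      using assms by (simp add: \<rho>_def power_divide field_simps) (simp add: power2_eq_square algebra_simps)
    then show ?thesis
      using assms by (simp add: normal_density_def exp_add[symmetric] del: exp_add)
  qed
  have pw: "\<bar>?p x - ?q x\<bar> \<le> \<rho> / 2 * ?p x + (?p x - 2 * ?q x + exp (\<rho>\<^sup>2) * ?r x) / (2 * \<rho>)" for x
  proof -
    have p: "0 < ?p x" using assms by (simp add: normal_density_pos)
    define w where "w = ?p x - 2 * ?q x + exp (\<rho>\<^sup>2) * ?r x"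
    define d where "d = \<bar>?p x - ?q x\<bar>"
    have "d * d = ?p x * w"
      using sq[of x] by (simp add: w_def d_def abs_if algebra_simps)
    \<comment> \<open>Here \<open>w = (p - q)\<^sup>2 / p\<close>.\<close>
    then have "?p x * (\<rho>\<^sup>2 * ?p x + w - 2 * \<rho> * d) = (\<rho> * ?p x - d)\<^sup>2"
      by (simp add: power2_eq_square algebra_simps)
    then have "0 \<le> ?p x * (\<rho>\<^sup>2 * ?p x + w - 2 * \<rho> * d)" by simp
    then have "2 * \<rho> * d \<le> \<rho>\<^sup>2 * ?p x + w"
      using p by (simp add: zero_le_mult_iff)
    then have "d \<le> \<rho> / 2 * ?p x + w / (2 * \<rho>)"
      using \<rho> by (simp add: field_simps power2_eq_square)
    then show ?thesis by (simp add: w_def d_def)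
  qed
  have "(\<integral>x. \<bar>?p x - ?q x\<bar> \<partial>lborel)
      \<le> (\<integral>x. \<rho> / 2 * ?p x + (?p x - 2 * ?q x + exp (\<rho>\<^sup>2) * ?r x) / (2 * \<rho>) \<partial>lborel)"
    using assms pw by (intro integral_mono) auto
  also have "\<dots> = \<rho> / 2 + (exp (\<rho>\<^sup>2) - 1) / (2 * \<rho>)"
    using assms by simp
  also have "\<dots> \<le> \<rho> / 2 + (2 * \<rho>\<^sup>2) / (2 * \<rho>)"
  proof -
    have "exp (\<rho>\<^sup>2) \<le> 1 + \<rho>\<^sup>2 + (\<rho>\<^sup>2)\<^sup>2"
      using \<rho> by (intro exp_bound) (auto simp: power_le_one)
    moreover have "(\<rho>\<^sup>2)\<^sup>2 \<le> \<rho>\<^sup>2"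
      using \<rho> power_decreasing[of 2 4 \<rho>] by simp
    ultimately show ?thesis
      using \<rho> by (intro add_left_mono divide_right_mono) auto
  qed
  also have "\<dots> \<le> 2 * \<rho>" using \<rho> by (simp add: power2_eq_square)
  finally show ?thesis by (simp add: \<rho>_def)
qed simp

text \<open>
  For shifts larger than the standard deviation the trivial bound \<open>2 * B\<close> suffices, so the
  estimate is linear in the shift without any restriction on its size.
\<close>

lemma (in prob_space) normal_expectation_shift:
  fixes X :: "'a \<Rightarrow> real" and \<psi> :: "real \<Rightarrow> real"
  assumes X: "distributed M lborel X (normal_density 0 v)" and v: "0 < v"
    and [measurable]: "\<psi> \<in> borel_measurable borel" and B: "\<And>x. \<bar>\<psi> x\<bar> \<le> B"
  shows "\<bar>expectation (\<lambda>x. \<psi> (a + X x)) - expectation (\<lambda>x. \<psi> (b + X x))\<bar> \<le> 2 * B * (\<bar>a - b\<bar> / v)"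
proof -
  have [measurable]: "X \<in> borel_measurable M"
    using X by (auto simp: distributed_def)
  have B0: "0 \<le> B" using B[of 0] by simp
  have D: "distributed M lborel (\<lambda>x. c + X x) (normal_density c v)" for c
    using normal_density_affine[OF X v, of 1 c] by simp
  have E: "expectation (\<lambda>x. \<psi> (c + X x)) = (\<integral>x. normal_density c v x * \<psi> x \<partial>lborel)" for c
    by (rule distributed_integral[OF D, symmetric]) auto
  have I: "integrable lborel (\<lambda>x. normal_density c v x * \<psi> x)" for c
  proof (rule Bochner_Integration.integrable_bound)
    show "integrable lborel (\<lambda>x. B * normal_density c v x)" using v by simp
    show "AE x in lborel. norm (normal_density c v x * \<psi> x) \<le> norm (B * normal_density c v x)"
      using B B0 by (auto simp: abs_mult mult.commute intro!: mult_right_mono)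
  qed simp
  show ?thesis
  proof (cases "\<bar>a - b\<bar> \<le> v")
    case True
    have "expectation (\<lambda>x. \<psi> (a + X x)) - expectation (\<lambda>x. \<psi> (b + X x))
        = (\<integral>x. (normal_density a v x - normal_density b v x) * \<psi> x \<partial>lborel)"
      unfolding E by (subst Bochner_Integration.integral_diff[OF I I, symmetric]) (simp add: algebra_simps)
    also have "\<bar>\<dots>\<bar> \<le> (\<integral>x. B * \<bar>normal_density a v x - normal_density b v x\<bar> \<partial>lborel)"
    proof (rule integral_abs_bound[THEN order_trans], rule integral_mono)
      show "integrable lborel (\<lambda>x. \<bar>(normal_density a v x - normal_density b v x) * \<psi> x\<bar>)"
        using Bochner_Integration.integrable_diff[OF I[of a] I[of b]]
        by (intro integrable_abs) (simp add: algebra_simps)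
      show "\<bar>(normal_density a v x - normal_density b v x) * \<psi> x\<bar>
        \<le> B * \<bar>normal_density a v x - normal_density b v x\<bar>" for x
        using B[of x] by (simp add: abs_mult mult.commute mult_right_mono)
    qed (use v in auto)
    also have "\<dots> \<le> B * (2 * (\<bar>a - b\<bar> / v))"
      using mult_left_mono[OF normal_density_shift_L1[OF v True] B0] by simp
    finally show ?thesis by (simp add: mult_ac)
  next
    case False
    have b: "\<bar>expectation (\<lambda>x. \<psi> (c + X x))\<bar> \<le> B" for c
    proof -
      have "\<bar>expectation (\<lambda>x. \<psi> (c + X x))\<bar> \<le> expectation (\<lambda>x. B)"
        by (rule integral_abs_bound[THEN order_trans], rule integral_mono)
          (use B in \<open>auto intro!: integrable_const_bound[of _ B]\<close>)
      then show ?thesis by (simp add: prob_space)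
    qed
    have "1 \<le> \<bar>a - b\<bar> / v" using False v by simp
    then have "2 * B * 1 \<le> 2 * B * (\<bar>a - b\<bar> / v)" using B0 by (intro mult_left_mono) auto
    then show ?thesis using b[of a] b[of b] by linarith
  qed
qed

section \<open>Linear equations with additive noise as limits of Riemann sums\<close>

text \<open>
  The partition has \<open>N + 1\<close> cells, so that \<open>N = 0\<close> is not degenerate.
\<close>

definition grid :: "real \<Rightarrow> real \<Rightarrow> nat \<Rightarrow> nat \<Rightarrow> real" where
  "grid t u N i = t + (u - t) * (real i / real (Suc N))"

lemma grid_0 [simp]: "grid t u N 0 = t"
  by (simp add: grid_def)

lemma grid_last [simp]: "grid t u N (Suc N) = u"
  by (simp add: grid_def)

lemma grid_step: "grid t u N (Suc i) - grid t u N i = (u - t) / real (Suc N)"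
proof -
  have "real (Suc i) / real (Suc N) = real i / real (Suc N) + 1 / real (Suc N)"
    by (simp add: add_divide_distrib)
  then show ?thesis unfolding grid_def by (simp only: distrib_left) simp
qed

lemma grid_mono: "t \<le> u \<Longrightarrow> i \<le> j \<Longrightarrow> grid t u N i \<le> grid t u N j"
  unfolding grid_def by (intro add_left_mono mult_left_mono divide_right_mono) auto

lemma grid_mem: "t \<le> u \<Longrightarrow> i \<le> Suc N \<Longrightarrow> grid t u N i \<in> {t..u}"
  using grid_mono[of t u 0 i N] grid_mono[of t u i "Suc N" N] by simp

text \<open>
  The integrating factor \<open>p\<close> satisfies \<open>p' = - a * p\<close>.  Replacing the increment of \<open>p * y\<close>, the
  integrated form of \<open>p dy + y dp = \<sigma> p dw\<close>, by the increment of the noise with \<open>p\<close> frozen at the left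
  endpoint leaves an error whose integrand is a difference of values of the continuous function
  \<open>(x, v) \<mapsto> p x * y v\<close> at nearby points.  Only \<open>p\<close> is differentiated, so this
  applies to Brownian paths \<open>w\<close>.
\<close>

lemma linear_equation_increment:
  fixes a y w :: "real \<Rightarrow> real"
  assumes cont: "continuous_on {t..u} a" "continuous_on {t..u} y"
    and y: "\<And>v. v \<in> {t..u} \<Longrightarrow> y v = s + integral {t..v} (\<lambda>z. a z * y z) + \<sigma> * (w v - w t)"
    and xz: "t \<le> x" "x \<le> z" "z \<le> u"
  defines "p \<equiv> \<lambda>v. exp (- integral {t..v} a)"
  shows "((\<lambda>v. a v * (p x * y v - p v * y z)) has_integral
           p z * y z - p x * y x - \<sigma> * (p x * (w z - w x))) {x..z}"
proof -
  have sub: "continuous_on {x..z} a" "continuous_on {x..z} y"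
    using cont xz by (auto intro: continuous_on_subset)
  have "((\<lambda>v. - (a v * p v)) has_integral p z - p x) {x..z}"
  proof (rule fundamental_theorem_of_calculus[OF \<open>x \<le> z\<close>])
    fix v assume v: "v \<in> {x..z}"
    have "((\<lambda>v. integral {t..v} a) has_real_derivative a v) (at v within {t..u})"
      using cont v xz by (intro integral_has_real_derivative) auto
    then have "(p has_real_derivative - (a v * p v)) (at v within {t..u})"
      unfolding p_def by (auto intro!: derivative_eq_intros)
    then have "(p has_real_derivative - (a v * p v)) (at v within {x..z})"
      by (rule DERIV_subset) (use xz in auto)
    then show "(p has_vector_derivative - (a v * p v)) (at v within {x..z})"
      by (simp add: has_real_derivative_iff_has_vector_derivative)
  qed
  then have P: "((\<lambda>v. - (a v * p v) * y z) has_integral (p z - p x) * y z) {x..z}"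
    by (rule has_integral_mult_left)
  have "integral {t..z} (\<lambda>v. a v * y v) = integral {t..x} (\<lambda>v. a v * y v) + integral {x..z} (\<lambda>v. a v * y v)"
    using xz cont
    by (intro Henstock_Kurzweil_Integration.integral_combine[symmetric] integrable_continuous_interval
        continuous_intros continuous_on_subset[of "{t..u}" _ "{t..z}"]) auto
  then have "integral {x..z} (\<lambda>v. a v * y v) = y z - y x - \<sigma> * (w z - w x)"
    using y[of z] y[of x] xz by (simp add: algebra_simps)
  moreover have "((\<lambda>v. a v * y v) has_integral integral {x..z} (\<lambda>v. a v * y v)) {x..z}"
    using sub by (intro integrable_integral integrable_continuous_interval continuous_intros)
  ultimately have "((\<lambda>v. a v * y v) has_integral y z - y x - \<sigma> * (w z - w x)) {x..z}"
    by simp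
  then have "((\<lambda>v. p x * (a v * y v)) has_integral p x * (y z - y x - \<sigma> * (w z - w x))) {x..z}"
    by (rule has_integral_mult_right)
  from has_integral_add[OF this P] show ?thesis
    by (simp add: algebra_simps)
qed

text \<open>
  Telescoping the increments of \<open>p * y\<close>, the errors add up to at most the length of the interval
  times the modulus of continuity of \<open>(x, v) \<mapsto> p x * y v\<close> at the mesh size.  The statement is the
  variation of constants formula with its Wiener integral \<open>\<integral> p dw\<close> left as a limit of sums, each of
  which is normal when \<open>w\<close> is a Brownian path.
\<close>

lemma linear_equation_riemann_sums:
  fixes a y w :: "real \<Rightarrow> real"
  assumes "t \<le> u" and cont: "continuous_on {t..u} a" "continuous_on {t..u} y"
    and y: "\<And>v. v \<in> {t..u} \<Longrightarrow> y v = s + integral {t..v} (\<lambda>z. a z * y z) + \<sigma> * (w v - w t)"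
  shows "(\<lambda>N. s + \<sigma> * (\<Sum>i<Suc N. exp (- integral {t..grid t u N i} a) *
              (w (grid t u N (Suc i)) - w (grid t u N i))))
           \<longlonglongrightarrow> exp (- integral {t..u} a) * y u"
proof (rule LIMSEQ_I)
  fix e :: real assume "0 < e"
  define p where "p = (\<lambda>v. exp (- integral {t..v} a))"
  have p_cont: "continuous_on {t..u} p"
    unfolding p_def using cont
    by (intro continuous_intros indefinite_integral_continuous_1 integrable_continuous_interval)
  obtain K where K: "0 < K" "\<And>v. v \<in> {t..u} \<Longrightarrow> \<bar>a v\<bar> \<le> K"
    using compact_imp_bounded[OF compact_continuous_image[OF cont(1)]]
    by (auto simp: bounded_pos image_iff)
  define \<epsilon> where "\<epsilon> = e / (2 * (K * (u - t) + 1))"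
  have D: "0 < 2 * (K * (u - t) + 1)" using K \<open>t \<le> u\<close> by (simp add: add_nonneg_pos)
  have \<epsilon>: "0 < \<epsilon>" using D \<open>0 < e\<close> by (simp add: \<epsilon>_def)
  have \<epsilon>e: "K * \<epsilon> * (u - t) < e"
  proof -
    have "\<epsilon> * (2 * (K * (u - t) + 1)) = e" using D by (simp add: \<epsilon>_def)
    then have "2 * (K * \<epsilon> * (u - t)) + 2 * \<epsilon> = e" by (simp add: algebra_simps)
    moreover have "0 \<le> K * \<epsilon> * (u - t)" using K \<epsilon> \<open>t \<le> u\<close> by simp
    ultimately show ?thesis using \<epsilon> by linarith
  qed
  have "continuous_on ({t..u} \<times> {t..u}) (\<lambda>(x, v). p x * y v)"
    unfolding case_prod_beta
    by (intro continuous_intros continuous_on_compose2[OF p_cont] continuous_on_compose2[OF cont(2)]) auto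
  then have "uniformly_continuous_on ({t..u} \<times> {t..u}) (\<lambda>(x, v). p x * y v)"
    by (intro compact_uniformly_continuous compact_Times) auto
  then obtain d where d: "0 < d" and
    unif: "\<And>x v x' v'. x \<in> {t..u} \<Longrightarrow> v \<in> {t..u} \<Longrightarrow> x' \<in> {t..u} \<Longrightarrow> v' \<in> {t..u} \<Longrightarrow>
       dist (x', v') (x, v) < d \<Longrightarrow> dist (p x' * y v') (p x * y v) < \<epsilon>"
    using \<epsilon> unfolding uniformly_continuous_on_def by (force simp: case_prod_beta)
  obtain N0 :: nat where N0: "2 * (u - t) / d < real N0" using reals_Archimedean2 by blast
  show "\<exists>no. \<forall>N\<ge>no. norm (s + \<sigma> * (\<Sum>i<Suc N. exp (- integral {t..grid t u N i} a) *
              (w (grid t u N (Suc i)) - w (grid t u N i))) - exp (- integral {t..u} a) * y u) < e"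
  proof (intro exI[of _ N0] allI impI)
    fix N assume "N0 \<le> N"
    let ?g = "grid t u N"
    define \<Delta> where "\<Delta> = (u - t) / real (Suc N)"
    have \<Delta>: "0 \<le> \<Delta>" "2 * \<Delta> < d"
    proof -
      have "2 * (u - t) / d < real (Suc N)" using N0 \<open>N0 \<le> N\<close> by linarith
      then show "2 * \<Delta> < d" using d by (simp add: \<Delta>_def field_simps)
    qed (use \<open>t \<le> u\<close> in \<open>simp add: \<Delta>_def\<close>)
    define err where "err i = p (?g (Suc i)) * y (?g (Suc i)) - p (?g i) * y (?g i)
        - \<sigma> * (p (?g i) * (w (?g (Suc i)) - w (?g i)))" for i
    have err: "\<bar>err i\<bar> \<le> K * \<epsilon> * \<Delta>" if "i < Suc N" for i
    proof -
      have mem: "?g i \<in> {t..u}" "?g (Suc i) \<in> {t..u}" "?g i \<le> ?g (Suc i)"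
        using that \<open>t \<le> u\<close> by (auto simp del: atLeastAtMost_iff intro: grid_mem grid_mono)
      have step: "?g (Suc i) - ?g i = \<Delta>" by (simp add: grid_step \<Delta>_def)
      have "((\<lambda>v. a v * (p (?g i) * y v - p v * y (?g (Suc i)))) has_integral err i) {?g i..?g (Suc i)}"
        unfolding err_def p_def using mem by (intro linear_equation_increment[OF cont y]) auto
      then have "norm (err i) \<le> K * \<epsilon> * measure lborel {?g i..?g (Suc i)}"
      proof (intro has_integral_bound_real[where S="{}"])
        fix v assume "v \<in> {?g i..?g (Suc i)} - {}"
        then have v: "?g i \<le> v" "v \<le> ?g (Suc i)" by auto
        have "dist (?g i, v) (v, ?g (Suc i)) \<le> dist (?g i) v + dist v (?g (Suc i))"
          unfolding dist_Pair_Pair by (rule sqrt_sum_squares_le_sum) auto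
        also have "\<dots> < d" using v step \<Delta> by (simp add: dist_real_def)
        finally have "dist (p (?g i) * y v) (p v * y (?g (Suc i))) < \<epsilon>"
          using v mem by (intro unif) auto
        then have "\<bar>a v\<bar> * \<bar>p (?g i) * y v - p v * y (?g (Suc i))\<bar> \<le> K * \<epsilon>"
          using K v mem by (intro mult_mono) (auto simp: dist_real_def)
        then show "norm (a v * (p (?g i) * y v - p v * y (?g (Suc i)))) \<le> K * \<epsilon>"
          by (simp add: abs_mult)
      qed (use K \<epsilon> in auto)
      then show ?thesis using mem step by simp
    qed
    have "(\<Sum>i<Suc N. err i) = (p u * y u - p t * y t)
        - \<sigma> * (\<Sum>i<Suc N. p (?g i) * (w (?g (Suc i)) - w (?g i)))"
      using sum_lessThan_telescope[of "\<lambda>i. p (?g i) * y (?g i)" "Suc N"]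
      by (simp only: err_def sum_subtractf sum_distrib_left grid_0 grid_last)
    moreover have "p t * y t = s" using y[of t] \<open>t \<le> u\<close> by (simp add: p_def)
    ultimately have "\<bar>s + \<sigma> * (\<Sum>i<Suc N. p (?g i) * (w (?g (Suc i)) - w (?g i))) - p u * y u\<bar>
        = \<bar>\<Sum>i<Suc N. err i\<bar>" by simp
    also have "\<dots> \<le> (\<Sum>i<Suc N. K * \<epsilon> * \<Delta>)"
      by (rule order_trans[OF sum_abs sum_mono]) (use err in auto)
    also have "\<dots> = K * \<epsilon> * (u - t)" by (simp add: \<Delta>_def)
    finally show "norm (s + \<sigma> * (\<Sum>i<Suc N. exp (- integral {t..?g i} a) *
              (w (?g (Suc i)) - w (?g i))) - exp (- integral {t..u} a) * y u) < e"
      using \<epsilon>e by (simp add: p_def)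
  qed
qed

section \<open>Averaging along the flow\<close>

lemma brownian_increments_sum_normal:
  fixes c :: "nat \<Rightarrow> real"
  assumes BM: "brownian_motion M W" and "0 \<le> t" "t < u" and c: "\<And>i. i < Suc N \<Longrightarrow> 0 < c i"
  shows "distributed M lborel
     (\<lambda>x. \<Sum>i<Suc N. c i * (W (grid t u N (Suc i)) x - W (grid t u N i) x))
     (normal_density 0 (sqrt (\<Sum>i<Suc N. (c i * sqrt ((u - t) / real (Suc N)))\<^sup>2)))"
proof -
  interpret prob_space M using BM by (simp add: brownian_motion_def)
  let ?g = "grid t u N"
  define \<Delta> where "\<Delta> = (u - t) / real (Suc N)"
  have \<Delta>: "0 < \<Delta>" using \<open>t < u\<close> by (simp add: \<Delta>_def)
  have step: "?g (Suc i) - ?g i = \<Delta>" for i by (simp add: grid_step \<Delta>_def)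
  have less: "?g i < ?g (Suc i)" for i using step[of i] \<Delta> by linarith
  have "\<forall>(n::nat) \<tau>. 0 \<le> \<tau> 0 \<and> (\<forall>i<n. \<tau> i \<le> \<tau> (Suc i)) \<longrightarrow>
        indep_vars (\<lambda>_. borel) (\<lambda>i x. W (\<tau> (Suc i)) x - W (\<tau> i) x) {..<n}"
    using BM unfolding brownian_motion_def by blast
  from this[rule_format, of ?g "Suc N"]
  have ind: "indep_vars (\<lambda>_. borel) (\<lambda>i x. W (?g (Suc i)) x - W (?g i) x) {..<Suc N}"
    using \<open>0 \<le> t\<close> less by (simp add: less_imp_le)
  have ind': "indep_vars (\<lambda>_. borel) (\<lambda>i x. c i * (W (?g (Suc i)) x - W (?g i) x)) {..<Suc N}"
    by (rule indep_vars_compose2[OF ind, of "\<lambda>i z. c i * z"]) simp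
  have normal: "distributed M lborel (\<lambda>x. c i * (W (?g (Suc i)) x - W (?g i) x))
      (normal_density 0 (c i * sqrt \<Delta>))" if "i < Suc N" for i
  proof -
    have "0 \<le> ?g i"
      using grid_mem[of t u i N] that \<open>0 \<le> t\<close> \<open>t < u\<close> by simp
    then have "distributed M lborel (\<lambda>x. W (?g (Suc i)) x - W (?g i) x)
        (normal_density 0 (sqrt (?g (Suc i) - ?g i)))"
      using BM less[of i] unfolding brownian_motion_def by blast
    from normal_density_affine[OF this, of "c i" 0] c[OF that] \<Delta> step show ?thesis
      by simp
  qed
  have "distributed M lborel (\<lambda>x. \<Sum>i<Suc N. c i * (W (?g (Suc i)) x - W (?g i) x))
      (normal_density (\<Sum>i<Suc N. 0) (sqrt (\<Sum>i<Suc N. (c i * sqrt \<Delta>)\<^sup>2)))"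
    by (rule sum_indep_normal[OF _ _ ind']) (use c \<Delta> normal in auto)
  then show ?thesis by (simp only: sum.neutral_const \<Delta>_def)
qed

text \<open>
  The smoothing effect of the noise.  The two solutions are approximated by the same Riemann sum
  \<open>X N\<close> shifted by \<open>s\<close> and \<open>s'\<close> respectively, composed with the deterministic scaling \<open>exp (A u)\<close>,
  which is absorbed into the test function \<open>\<psi>\<close>.  As the weights of the increments are at least
  \<open>\<sigma> * exp (- (K * T))\<close>, the standard deviation of \<open>X N\<close> is at least \<open>\<sigma> * exp (- (K * T)) * sqrt (u - t)\<close>
  for every \<open>N\<close>.
\<close>

lemma flow_gradient_bound:
  fixes a :: "real \<Rightarrow> real" and \<phi> :: "real \<Rightarrow> real"
  assumes BM: "brownian_motion M W" and flow: "linear_sde_flow M W a \<sigma> T \<eta>"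
    and a: "continuous_on {0..T} a" "\<And>v. v \<in> {0..T} \<Longrightarrow> \<bar>a v\<bar> \<le> K" and "0 < \<sigma>"
    and tu: "0 \<le> t" "t < u" "u \<le> T"
    and \<phi>: "continuous_on UNIV \<phi>" "\<And>x. \<bar>\<phi> x\<bar> \<le> B"
  shows "\<bar>prob_space.expectation M (\<lambda>x. \<phi> (\<eta> s t u x)) -
          prob_space.expectation M (\<lambda>x. \<phi> (\<eta> s' t u x))\<bar>
         \<le> 2 * B * exp (K * T) / \<sigma> * \<bar>s - s'\<bar> / sqrt (u - t)"
proof -
  interpret prob_space M using BM by (simp add: brownian_motion_def)
  let ?g = "grid t u"
  have K: "0 \<le> K" using a(2)[of t] tu by simp
  have B: "0 \<le> B" using \<phi>(2)[of 0] by simp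
  define A where "A v = integral {t..v} a" for v
  define \<psi> where "\<psi> y = \<phi> (exp (A u) * y)" for y
  have [measurable]: "\<phi> \<in> borel_measurable borel"
    using \<phi>(1) by (rule borel_measurable_continuous_onI)
  have [measurable]: "\<psi> \<in> borel_measurable borel" unfolding \<psi>_def by measurable
  have A_bound: "A v \<le> K * T" if "v \<in> {t..u}" for v
  proof -
    have "norm (A v) \<le> integral {t..v} (\<lambda>_. K)"
      unfolding A_def using that tu a
      by (intro integral_norm_bound_integral integrable_continuous_interval continuous_on_subset[OF a(1)]) auto
    also have "\<dots> = K * (v - t)" using that by simp
    also have "\<dots> \<le> K * T" using that tu K by (intro mult_left_mono) auto
    finally show ?thesis by simp
  qed
  define X where "X N x = (\<Sum>i<Suc N. \<sigma> * exp (- A (?g N i)) * (W (?g N (Suc i)) x - W (?g N i) x))" for N x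
  define \<Delta> where "\<Delta> N = (u - t) / real (Suc N)" for N
  define sd where "sd N = sqrt (\<Sum>i<Suc N. (\<sigma> * exp (- A (?g N i)) * sqrt (\<Delta> N))\<^sup>2)" for N
  have X: "distributed M lborel (X N) (normal_density 0 (sd N))" for N
    unfolding X_def sd_def \<Delta>_def using \<open>0 < \<sigma>\<close> tu
    by (intro brownian_increments_sum_normal[OF BM]) auto
  have sd: "\<sigma> * exp (- (K * T)) * sqrt (u - t) \<le> sd N" for N
  proof -
    have "(\<Sum>i<Suc N. (\<sigma> * exp (- (K * T)) * sqrt (\<Delta> N))\<^sup>2)
        \<le> (\<Sum>i<Suc N. (\<sigma> * exp (- A (?g N i)) * sqrt (\<Delta> N))\<^sup>2)"
    proof (intro sum_mono power_mono mult_right_mono mult_left_mono)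
      fix i assume "i \<in> {..<Suc N}"
      then have "?g N i \<in> {t..u}" using tu by (intro grid_mem) auto
      from A_bound[OF this] show "exp (- (K * T)) \<le> exp (- A (?g N i))" by simp
    qed (use \<open>0 < \<sigma>\<close> tu in \<open>auto simp: \<Delta>_def\<close>)
    moreover have "(\<Sum>i<Suc N. (\<sigma> * exp (- (K * T)) * sqrt (\<Delta> N))\<^sup>2)
        = (\<sigma> * exp (- (K * T)))\<^sup>2 * (real (Suc N) * \<Delta> N)"
      using tu by (simp add: power_mult_distrib \<Delta>_def del: of_nat_Suc)
    moreover have "real (Suc N) * \<Delta> N = u - t" by (simp add: \<Delta>_def del: of_nat_Suc)
    ultimately have "sqrt ((\<sigma> * exp (- (K * T)))\<^sup>2 * (u - t)) \<le> sd N"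
      unfolding sd_def by (intro real_sqrt_le_mono) (simp only:)
    then show ?thesis using \<open>0 < \<sigma>\<close> by (simp add: real_sqrt_mult)
  qed
  define m where "m = \<sigma> * exp (- (K * T)) * sqrt (u - t)"
  have m: "0 < m" using \<open>0 < \<sigma>\<close> tu by (simp add: m_def)
  have [measurable]: "X N \<in> borel_measurable M" for N
    using X[of N] by (auto simp: distributed_def)
  have lim: "(\<lambda>N. expectation (\<lambda>x. \<psi> (z + X N x))) \<longlonglongrightarrow> expectation (\<lambda>x. \<phi> (\<eta> z t u x))" for z
  proof (rule integral_dominated_convergence[where w="\<lambda>_. B"])
    have mem: "t \<in> {0..T}" "u \<in> {t..T}" using tu by auto
    then show "(\<lambda>x. \<phi> (\<eta> z t u x)) \<in> borel_measurable M"
      using flow unfolding linear_sde_flow_def by (intro measurable_compose[of _ M borel \<phi>]) auto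
    have "AE x in M. continuous_on {t..T} (\<lambda>u. \<eta> z t u x) \<and>
           (\<forall>u\<in>{t..T}. \<eta> z t u x =
              z + integral {t..u} (\<lambda>v. a v * \<eta> z t v x) + \<sigma> * (W u x - W t x))"
      using flow mem unfolding linear_sde_flow_def by blast
    then show "AE x in M. (\<lambda>N. \<psi> (z + X N x)) \<longlonglongrightarrow> \<phi> (\<eta> z t u x)"
    proof (rule AE_mp, intro AE_I2 impI, elim conjE)
      fix x assume cont: "continuous_on {t..T} (\<lambda>u. \<eta> z t u x)"
        and eq: "\<forall>u\<in>{t..T}. \<eta> z t u x =
              z + integral {t..u} (\<lambda>v. a v * \<eta> z t v x) + \<sigma> * (W u x - W t x)"
      have "(\<lambda>N. z + \<sigma> * (\<Sum>i<Suc N. exp (- integral {t..?g N i} a) *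
              (W (?g N (Suc i)) x - W (?g N i) x))) \<longlonglongrightarrow> exp (- integral {t..u} a) * \<eta> z t u x"
      proof (rule linear_equation_riemann_sums)
        show "continuous_on {t..u} a" using a(1) by (rule continuous_on_subset) (use tu in auto)
        show "continuous_on {t..u} (\<lambda>u. \<eta> z t u x)"
          using cont by (rule continuous_on_subset) (use tu in auto)
      qed (use eq tu in auto)
      moreover have "\<sigma> * (\<Sum>i<Suc N. exp (- integral {t..?g N i} a) *
              (W (?g N (Suc i)) x - W (?g N i) x)) = X N x" for N
        unfolding X_def A_def sum_distrib_left by (simp only: mult.assoc)
      ultimately have "(\<lambda>N. z + X N x) \<longlonglongrightarrow> exp (- A u) * \<eta> z t u x"
        by (simp add: A_def)
      then have "(\<lambda>N. exp (A u) * (z + X N x)) \<longlonglongrightarrow> exp (A u) * (exp (- A u) * \<eta> z t u x)"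
        by (rule tendsto_mult_left)
      then have "(\<lambda>N. exp (A u) * (z + X N x)) \<longlonglongrightarrow> \<eta> z t u x"
        by (simp add: mult.assoc[symmetric] exp_add[symmetric] del: exp_add)
      then show "(\<lambda>N. \<psi> (z + X N x)) \<longlonglongrightarrow> \<phi> (\<eta> z t u x)"
        unfolding \<psi>_def using \<phi>(1) by (intro continuous_on_tendsto_compose[OF \<phi>(1)]) auto
    qed
  qed (use \<phi>(2) in \<open>auto simp: \<psi>_def\<close>)
  have "\<bar>expectation (\<lambda>x. \<psi> (s + X N x)) - expectation (\<lambda>x. \<psi> (s' + X N x))\<bar>
      \<le> 2 * B * (\<bar>s - s'\<bar> / m)" for N
  proof -
    have "\<bar>expectation (\<lambda>x. \<psi> (s + X N x)) - expectation (\<lambda>x. \<psi> (s' + X N x))\<bar>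
        \<le> 2 * B * (\<bar>s - s'\<bar> / sd N)"
      by (rule normal_expectation_shift[OF X]) (use sd[of N] m \<phi>(2) in \<open>auto simp: m_def \<psi>_def\<close>)
    also have "\<dots> \<le> 2 * B * (\<bar>s - s'\<bar> / m)"
      using sd[of N] m B by (intro mult_left_mono divide_left_mono mult_pos_pos) (auto simp: m_def)
    finally show ?thesis .
  qed
  then have "\<bar>expectation (\<lambda>x. \<phi> (\<eta> s t u x)) - expectation (\<lambda>x. \<phi> (\<eta> s' t u x))\<bar>
      \<le> 2 * B * (\<bar>s - s'\<bar> / m)"
    by (intro LIMSEQ_le_const2[OF tendsto_rabs[OF tendsto_diff[OF lim[of s] lim[of s']]]]) auto
  also have "2 * B * (\<bar>s - s'\<bar> / m) = 2 * B * exp (K * T) / \<sigma> * \<bar>s - s'\<bar> / sqrt (u - t)"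
    by (simp add: m_def exp_minus field_simps)
  finally show ?thesis .
qed

text \<open>
  The time integral in \<open>FK_map\<close> vanishes by convention when its integrand is not integrable.
  Continuity in \<open>u\<close> guarantees integrability, hence additivity of the integral in \<open>Psi\<close>.
\<close>

lemma flow_expectation:
  fixes F :: "real \<Rightarrow> real \<Rightarrow> real"
  assumes BM: "brownian_motion M W" and flow: "linear_sde_flow M W a \<sigma> T \<eta>"
    and F: "continuous_on (UNIV \<times> {0..T}) (\<lambda>(s, t). F s t)"
    and B: "\<And>s u. u \<in> {0..T} \<Longrightarrow> \<bar>F s u\<bar> \<le> B" and "t \<in> {0..T}"
  shows flow_integrable: "u \<in> {t..T} \<Longrightarrow> integrable M (\<lambda>x. F (\<eta> s t u x) u)"
    and flow_expectation_continuous: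
      "continuous_on {t..T} (\<lambda>u. prob_space.expectation M (\<lambda>x. F (\<eta> s t u x) u))"
proof -
  interpret prob_space M using BM by (simp add: brownian_motion_def)
  have meas: "(\<lambda>x. F (\<eta> s t u x) u) \<in> borel_measurable M" if "u \<in> {t..T}" for u
  proof -
    have "continuous_on UNIV (\<lambda>z. case (z, u) of (s, t) \<Rightarrow> F s t)"
      by (rule continuous_on_compose2[OF F]) (use that \<open>t \<in> _\<close> in \<open>auto intro!: continuous_intros\<close>)
    then have [measurable]: "(\<lambda>z. F z u) \<in> borel_measurable borel"
      by (intro borel_measurable_continuous_onI) simp
    have [measurable]: "\<eta> s t u \<in> borel_measurable M"
      using flow that \<open>t \<in> _\<close> unfolding linear_sde_flow_def by blast
    show ?thesis by measurable
  qed
  show "integrable M (\<lambda>x. F (\<eta> s t u x) u)" if "u \<in> {t..T}" for u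
    by (rule integrable_const_bound[of _ B]) (use that meas B \<open>t \<in> _\<close> in auto)
  show "continuous_on {t..T} (\<lambda>u. expectation (\<lambda>x. F (\<eta> s t u x) u))"
    unfolding continuous_on_sequentially comp_def
  proof (intro ballI allI impI, elim conjE)
    fix U u assume u: "u \<in> {t..T}" and U: "\<forall>n. U n \<in> {t..T}" "U \<longlonglongrightarrow> u"
    show "(\<lambda>n. expectation (\<lambda>x. F (\<eta> s t (U n) x) (U n))) \<longlonglongrightarrow> expectation (\<lambda>x. F (\<eta> s t u x) u)"
    proof (rule integral_dominated_convergence[where w="\<lambda>_. B"])
      have "AE x in M. continuous_on {t..T} (\<lambda>u. \<eta> s t u x)"
        using flow \<open>t \<in> _\<close> unfolding linear_sde_flow_def by (auto elim: AE_mp)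
      then show "AE x in M. (\<lambda>n. F (\<eta> s t (U n) x) (U n)) \<longlonglongrightarrow> F (\<eta> s t u x) u"
      proof (rule AE_mp, intro AE_I2 impI)
        fix x assume "continuous_on {t..T} (\<lambda>u. \<eta> s t u x)"
        then have "continuous_on {t..T} (\<lambda>u. case (\<eta> s t u x, u) of (s, t) \<Rightarrow> F s t)"
          by (intro continuous_on_compose2[OF F] continuous_intros) (use \<open>t \<in> _\<close> in auto)
        then show "(\<lambda>n. F (\<eta> s t (U n) x) (U n)) \<longlonglongrightarrow> F (\<eta> s t u x) u"
          using u U continuous_on_sequentially[of "{t..T}" "\<lambda>u. F (\<eta> s t u x) u"]
          by (simp add: comp_def)
      qed
      show "AE x in M. norm (F (\<eta> s t (U n) x) (U n)) \<le> B" for n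
      proof -
        have "t \<le> U n" "U n \<le> T" using U(1) by auto
        then show ?thesis using B[of "U n"] \<open>t \<in> _\<close> by auto
      qed
    qed (use meas u U in auto)
  qed
qed

text \<open>
  The zeroth order bound has no singular kernel, but it is stated with the same rate: \<open>1\<close> is at most
  \<open>sqrt T / sqrt (u - t)\<close>.  Thus a function and its Lipschitz constant gain the same factor.
\<close>

lemma flow_potential_bounds:
  fixes a :: "real \<Rightarrow> real" and F :: "real \<Rightarrow> real \<Rightarrow> real"
  assumes BM: "brownian_motion M W" and flow: "linear_sde_flow M W a \<sigma> T \<eta>"
    and a: "continuous_on {0..T} a" "\<And>v. v \<in> {0..T} \<Longrightarrow> \<bar>a v\<bar> \<le> K" and "0 < \<sigma>"
    and F: "continuous_on (UNIV \<times> {0..T}) (\<lambda>(s, t). F s t)" and "0 \<le> c"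
    and c: "\<And>s u. u \<in> {0..T} \<Longrightarrow> \<bar>F s u\<bar> \<le> c * sqrt (T - u) ^ n" and t: "t \<in> {0..T}"
  defines "V \<equiv> \<lambda>s. integral {t..T} (\<lambda>u. prob_space.expectation M (\<lambda>x. F (\<eta> s t u x) u))"
  shows flow_potential_abs_le:
      "\<bar>V s\<bar> \<le> 4 * (sqrt T * c) / sqrt (real n + 1) * sqrt (T - t) ^ (n + 1)"
    and flow_potential_lipschitz:
      "\<bar>V s - V s'\<bar> \<le>
        4 * (2 * exp (K * T) / \<sigma> * c * \<bar>s - s'\<bar>) / sqrt (real n + 1) * sqrt (T - t) ^ (n + 1)"
proof -
  interpret prob_space M using BM by (simp add: brownian_motion_def)
  have T: "0 \<le> T" "t \<le> T" "0 \<le> t" using t by auto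
  let ?E = "\<lambda>s u. expectation (\<lambda>x. F (\<eta> s t u x) u)"
  have F_bdd: "\<bar>F z u\<bar> \<le> c * sqrt T ^ n" if "u \<in> {0..T}" for z u
  proof -
    have "\<bar>F z u\<bar> \<le> c * sqrt (T - u) ^ n" using c that .
    also have "\<dots> \<le> c * sqrt T ^ n"
      using that \<open>0 \<le> c\<close> by (intro mult_left_mono power_mono) auto
    finally show ?thesis .
  qed
  have cont: "continuous_on {t..T} (?E z)" for z
    by (rule flow_expectation_continuous[OF BM flow F F_bdd t])
  have int: "?E z integrable_on {t..T}" for z
    using cont by (rule integrable_continuous_interval)
  show "\<bar>V s\<bar> \<le> 4 * (sqrt T * c) / sqrt (real n + 1) * sqrt (T - t) ^ (n + 1)"
    unfolding V_def
  proof (rule weakly_singular_integral_bound[OF T(2) _ int])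
    fix u assume u: "t < u" "u \<le> T"
    have "\<bar>?E s u\<bar> \<le> expectation (\<lambda>x. c * sqrt (T - u) ^ n)"
    proof (rule order_trans[OF integral_abs_bound integral_mono])
      show "integrable M (\<lambda>x. \<bar>F (\<eta> s t u x) u\<bar>)"
        using flow_integrable[OF BM flow F F_bdd t, of u] u by (intro integrable_abs) auto
    qed (use c u T in auto)
    also have "\<dots> = c * sqrt (T - u) ^ n" by (simp add: prob_space)
    finally have "\<bar>?E s u\<bar> * sqrt (u - t) \<le> c * sqrt (T - u) ^ n * sqrt T"
      using u T \<open>0 \<le> c\<close> by (intro mult_mono) auto
    then show "\<bar>?E s u\<bar> \<le> sqrt T * c * sqrt (T - u) ^ n / sqrt (u - t)"
      using u by (simp add: pos_le_divide_eq mult_ac)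
  qed (use T \<open>0 \<le> c\<close> in auto)
  have "V s - V s' = integral {t..T} (\<lambda>u. ?E s u - ?E s' u)"
    unfolding V_def by (rule Henstock_Kurzweil_Integration.integral_diff[OF int int, symmetric])
  moreover have "\<bar>integral {t..T} (\<lambda>u. ?E s u - ?E s' u)\<bar> \<le>
      4 * (2 * exp (K * T) / \<sigma> * c * \<bar>s - s'\<bar>) / sqrt (real n + 1) * sqrt (T - t) ^ (n + 1)"
  proof (rule weakly_singular_integral_bound[OF T(2)])
    fix u assume u: "t < u" "u \<le> T"
    have "continuous_on UNIV (\<lambda>z. case (z, u) of (s, t) \<Rightarrow> F s t)"
      by (rule continuous_on_compose2[OF F]) (use u T in \<open>auto intro!: continuous_intros\<close>)
    then have "continuous_on UNIV (\<lambda>z. F z u)" by simp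
    then have "\<bar>?E s u - ?E s' u\<bar>
        \<le> 2 * (c * sqrt (T - u) ^ n) * exp (K * T) / \<sigma> * \<bar>s - s'\<bar> / sqrt (u - t)"
      using u T c by (intro flow_gradient_bound[OF BM flow a \<open>0 < \<sigma>\<close>]) auto
    then show "\<bar>?E s u - ?E s' u\<bar>
        \<le> 2 * exp (K * T) / \<sigma> * c * \<bar>s - s'\<bar> * sqrt (T - u) ^ n / sqrt (u - t)"
      by (simp add: mult_ac)
  qed (use int \<open>0 \<le> c\<close> \<open>0 < \<sigma>\<close> in \<open>auto intro: Henstock_Kurzweil_Integration.integrable_diff\<close>)
  ultimately show "\<bar>V s - V s'\<bar> \<le>
      4 * (2 * exp (K * T) / \<sigma> * c * \<bar>s - s'\<bar>) / sqrt (real n + 1) * sqrt (T - t) ^ (n + 1)"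
    by simp
qed

section \<open>Elementary estimates\<close>

lemma exp_minus_lipschitz:
  fixes x y :: real
  assumes "0 \<le> x" "0 \<le> y"
  shows "\<bar>exp (- x) - exp (- y)\<bar> \<le> \<bar>x - y\<bar>"
proof -
  have *: "\<bar>exp (- x) - exp (- y)\<bar> \<le> \<bar>x - y\<bar>" if "0 \<le> x" "x \<le> y" for x y :: real
  proof -
    have "exp (- x) - exp (- y) = exp (- x) * (1 - exp (- (y - x)))"
      by (simp add: right_diff_distrib exp_add[symmetric] del: exp_add)
    also have "\<dots> \<le> 1 * (y - x)"
    proof (intro mult_mono)
      show "1 - exp (- (y - x)) \<le> y - x"
        using exp_ge_add_one_self[of "- (y - x)"] by linarith
    qed (use that in auto)
    finally show ?thesis using that by simp
  qed
  show ?thesis using *[of x y] *[of y x] assms by linarith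
qed

lemma has_real_derivative_abs_le:
  fixes f :: "real \<Rightarrow> real"
  assumes "(f has_real_derivative D) (at s)" and "\<And>z. \<bar>f z - f s\<bar> \<le> c * \<bar>z - s\<bar>"
  shows "\<bar>D\<bar> \<le> c"
proof (rule tendsto_upperbound)
  show "((\<lambda>z. \<bar>(f z - f s) / (z - s)\<bar>) \<longlongrightarrow> \<bar>D\<bar>) (at s)"
    using assms(1) by (intro tendsto_rabs) (simp add: has_field_derivative_iff)
  show "\<forall>\<^sub>F z in at s. \<bar>(f z - f s) / (z - s)\<bar> \<le> c"
    using assms(2) by (auto simp: eventually_at_filter abs_divide divide_le_eq intro!: always_eventually)
qed simp

text \<open>
  The left-hand side divided by \<open>fact n\<close> is one term of the exponential series of \<open>exp n\<close>.
\<close>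

lemma power_self_le_exp_fact: "real n ^ n \<le> exp (real n) * fact n"
proof -
  have "(\<Sum>i\<in>{n}. inverse (fact i) *\<^sub>R real n ^ i) \<le> exp (real n)"
    unfolding exp_def by (intro sum_le_suminf summable_exp_generic) auto
  then show ?thesis by (simp add: field_simps)
qed

text \<open>
  The margin \<open>d = 1/2 - \<delta>\<close> leaves the factor \<open>n powr (- d * n)\<close>, which beats every geometric
  sequence.
\<close>

lemma power_over_sqrt_fact_bigo:
  fixes K \<delta> :: real
  assumes "0 < K" "\<delta> < 1 / 2"
  shows "(\<lambda>n. K ^ n / sqrt (fact n)) \<in> O(\<lambda>n. real n powr (- \<delta> * real n))"
proof -
  define c where "c = \<bar>ln K\<bar> + 1 / 2"
  define d where "d = 1 / 2 - \<delta>"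
  have d: "0 < d" and c: "0 < c" using assms by (auto simp: d_def c_def)
  have "(\<lambda>n. K ^ n / sqrt (fact n)) \<in> O(\<lambda>n. exp (c * real n) * real n powr (- (1 / 2) * real n))"
  proof (intro bigoI[of _ 1] eventually_mono[OF eventually_gt_at_top[of 0]])
    fix n :: nat assume n: "0 < n"
    have "sqrt (real n ^ n) \<le> sqrt (exp (real n) * fact n)"
      using power_self_le_exp_fact by (rule real_sqrt_le_mono)
    moreover have "sqrt (real n ^ n) = real n powr (1 / 2 * real n)"
      using n by (simp add: powr_half_sqrt[symmetric] powr_realpow[symmetric] powr_powr mult.commute)
    moreover have "sqrt (exp (real n)) = exp (real n / 2)"
      by (rule real_sqrt_unique) (simp_all add: power2_eq_square exp_add[symmetric] del: exp_add)
    ultimately have "real n powr (1 / 2 * real n) \<le> exp (real n / 2) * sqrt (fact n)"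
      by (simp add: real_sqrt_mult)
    then have "1 / sqrt (fact n) \<le> exp (real n / 2) * real n powr (- (1 / 2) * real n)"
      using n by (simp add: powr_minus field_simps)
    then have "K ^ n * (1 / sqrt (fact n)) \<le> K ^ n * (exp (real n / 2) * real n powr (- (1 / 2) * real n))"
      using assms by (intro mult_left_mono) auto
    also have "\<dots> \<le> exp (c * real n) * real n powr (- (1 / 2) * real n)"
    proof -
      have "K ^ n = exp (real n * ln K)" using assms by (simp add: exp_of_nat_mult)
      then have "K ^ n * exp (real n / 2) = exp (real n * (ln K + 1 / 2))"
        by (simp add: exp_add[symmetric] distrib_left)
      also have "\<dots> \<le> exp (c * real n)"
        unfolding exp_le_cancel_iff mult.commute[of c] by (intro mult_left_mono) (auto simp: c_def)
      finally show ?thesis unfolding mult.assoc[symmetric] by (rule mult_right_mono) simp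
    qed
    finally show "norm (K ^ n / sqrt (fact n)) \<le> 1 * norm (exp (c * real n) * real n powr (- (1 / 2) * real n))"
      using assms by simp
  qed
  also have "(\<lambda>n. exp (c * real n) * real n powr (- (1 / 2) * real n)) =
      (\<lambda>n. exp (c * real n) * real n powr (- d * real n) * real n powr (- \<delta> * real n))"
    by (simp add: d_def mult.assoc powr_add[symmetric] algebra_simps)
  also have "\<dots> \<in> O(\<lambda>n. 1 * real n powr (- \<delta> * real n))"
  proof (intro landau_o.big.mult landau_o.big_refl)
    show "(\<lambda>n. exp (c * real n) * real n powr (- d * real n)) \<in> O(\<lambda>n. 1)"
      using c d by real_asymp
  qed
  finally show ?thesis by simp
qed

section \<open>The coefficients and the integrand of the Feynman--Kac mapping\<close>

text \<open>
  Up to the positive factor \<open>1 / \<sigma>^4\<close>, the radicand of \<open>\<vartheta>\<close> is \<open>(\<gamma> * k + (1 - \<gamma>) * \<kappa>)\<^sup>2 - \<gamma> * k\<^sup>2\<close> with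
  \<open>k = \<kappa> + r\<close>.  The hypothesis \<open>r \<le> \<kappa>\<close> gives \<open>\<kappa> \<ge> k / 2\<close>, so the first square is at least
  \<open>((1 + \<gamma>) / 2 * k)\<^sup>2\<close>, and \<open>(1 + \<gamma>) / 2\<close> exceeds the geometric mean \<open>sqrt \<gamma>\<close> of
  \<open>1\<close> and \<open>\<gamma>\<close>.
\<close>

lemma vartheta_bounds:
  assumes "0 < \<gamma>" "\<gamma> < 1" "0 < \<kappa>" "0 < \<sigma>" "r \<le> \<kappa>" "0 < kappa1 \<kappa> r"
  shows "0 < vartheta \<gamma> \<kappa> r \<sigma>" "vartheta \<gamma> \<kappa> r \<sigma> \<le> gamma2_check \<gamma> \<kappa> r \<sigma>"
proof -
  define k where "k = kappa1 \<kappa> r"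
  have k: "0 < k" "k \<le> 2 * \<kappa>" using assms by (auto simp: k_def kappa1_def)
  have g1: "0 < gamma1 \<gamma> \<sigma>" using assms by (simp add: gamma1_def)
  have c: "0 < gamma2_check \<gamma> \<kappa> r \<sigma>"
    using assms g1 by (auto simp: gamma2_check_def gamma2_def intro!: divide_pos_pos add_pos_pos)
  have c3: "0 \<le> gamma3_check \<gamma> \<kappa> r \<sigma>"
    using assms g1 by (simp add: gamma3_check_def gamma3_def)
  have "\<gamma> * k\<^sup>2 < (\<gamma> * k + (1 - \<gamma>) * \<kappa>)\<^sup>2"
  proof -
    have "((1 + \<gamma>) / 2)\<^sup>2 - \<gamma> = ((1 - \<gamma>) / 2)\<^sup>2"
      by (simp add: power2_eq_square field_simps)
    moreover have "0 < ((1 - \<gamma>) / 2)\<^sup>2" using assms by simp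
    ultimately have "\<gamma> < ((1 + \<gamma>) / 2)\<^sup>2" by linarith
    then have "\<gamma> * k\<^sup>2 < ((1 + \<gamma>) / 2)\<^sup>2 * k\<^sup>2" using k by simp
    also have "\<dots> = (\<gamma> * k + (1 - \<gamma>) * (k / 2))\<^sup>2"
      by (simp add: power_mult_distrib[symmetric]) (simp add: field_simps)
    also have "\<dots> \<le> (\<gamma> * k + (1 - \<gamma>) * \<kappa>)\<^sup>2"
      using assms k by (intro power_mono add_left_mono mult_left_mono) auto
    finally show ?thesis .
  qed
  then have "\<gamma> * k\<^sup>2 / \<sigma>^4 < (\<gamma> * k + (1 - \<gamma>) * \<kappa>)\<^sup>2 / \<sigma>^4"
    using assms by (intro divide_strict_right_mono) auto
  moreover have "gamma3_check \<gamma> \<kappa> r \<sigma> = \<gamma> * k\<^sup>2 / \<sigma>^4"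
    using assms by (simp add: gamma3_check_def gamma3_def gamma1_def k_def field_simps)
  moreover have "(gamma2_check \<gamma> \<kappa> r \<sigma>)\<^sup>2 = (\<gamma> * k + (1 - \<gamma>) * \<kappa>)\<^sup>2 / \<sigma>^4"
  proof -
    have "gamma2_check \<gamma> \<kappa> r \<sigma> = (\<gamma> * k + (1 - \<gamma>) * \<kappa>) / \<sigma>\<^sup>2"
      using assms by (simp add: gamma2_check_def gamma2_def gamma1_def k_def field_simps)
    then show ?thesis by (simp add: power_divide)
  qed
  ultimately show "0 < vartheta \<gamma> \<kappa> r \<sigma>" by (simp add: vartheta_def)
  have "vartheta \<gamma> \<kappa> r \<sigma> \<le> sqrt ((gamma2_check \<gamma> \<kappa> r \<sigma>)\<^sup>2)"
    unfolding vartheta_def using c3 by (intro real_sqrt_le_mono) simp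
  then show "vartheta \<gamma> \<kappa> r \<sigma> \<le> gamma2_check \<gamma> \<kappa> r \<sigma>" using c by simp
qed

text \<open>
  The denominator in \<open>g\<close> is smallest at \<open>t = T\<close>, where it equals \<open>2 * \<vartheta>\<close> and \<open>g\<close> vanishes.
\<close>

lemma g_fun_nonneg_continuous:
  assumes "0 < \<gamma>" "\<gamma> < 1" "0 < \<kappa>" "0 < \<sigma>" "r \<le> \<kappa>" "0 < kappa1 \<kappa> r"
  shows g_fun_nonneg: "t \<le> T \<Longrightarrow> 0 \<le> g_fun \<gamma> \<kappa> r \<sigma> T t"
    and continuous_on_g_fun: "continuous_on {0..T} (g_fun \<gamma> \<kappa> r \<sigma> T)"
proof -
  define c where "c = gamma2_check \<gamma> \<kappa> r \<sigma>"
  define v where "v = vartheta \<gamma> \<kappa> r \<sigma>"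
  define den where "den t = exp (omega \<gamma> \<kappa> r \<sigma> * (T - t)) * (c + v) - c + v" for t
  have v: "0 < v" "v \<le> c" using vartheta_bounds[OF assms] by (simp_all add: v_def c_def)
  have g: "g_fun \<gamma> \<kappa> r \<sigma> T t = c - v - 2 * v * (c - v) / den t" for t
    by (simp add: g_fun_def Let_def c_def v_def den_def)
  have "0 \<le> omega \<gamma> \<kappa> r \<sigma>"
    using v assms by (simp add: omega_def gamma1_def v_def)
  then have den: "2 * v \<le> den t" if "t \<le> T" for t
  proof -
    have "1 * (c + v) \<le> exp (omega \<gamma> \<kappa> r \<sigma> * (T - t)) * (c + v)"
      using v that \<open>0 \<le> omega \<gamma> \<kappa> r \<sigma>\<close> by (intro mult_right_mono) auto
    then show ?thesis by (simp add: den_def)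
  qed
  show "0 \<le> g_fun \<gamma> \<kappa> r \<sigma> T t" if "t \<le> T"
  proof -
    have "2 * v * (c - v) \<le> den t * (c - v)"
      using den[OF that] v by (intro mult_right_mono) auto
    then have "2 * v * (c - v) / den t \<le> c - v"
      using den[OF that] v by (simp add: divide_le_eq mult_ac)
    then show ?thesis by (simp add: g)
  qed
  have "continuous_on {0..T} (\<lambda>t. c - v - 2 * v * (c - v) / den t)"
  proof (intro continuous_intros ballI)
    show "continuous_on {0..T} den" unfolding den_def by (intro continuous_intros)
    show "den t \<noteq> 0" if "t \<in> {0..T}" for t using den[of t] v that by auto
  qed
  then show "continuous_on {0..T} (g_fun \<gamma> \<kappa> r \<sigma> T)" by (simp add: g[abs_def])
qed

lemma fk_spaceD:
  assumes "h \<in> fk_space \<gamma> \<kappa> r \<sigma> varpi T"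
  shows "continuous_on (UNIV \<times> {0..T}) (\<lambda>(s, t). h s t)"
    and "continuous_on (UNIV \<times> {0..T}) (\<lambda>(s, t). ds h s t)"
    and "t \<in> {0..T} \<Longrightarrow> 0 \<le> h s t" "t \<in> {0..T} \<Longrightarrow> h s t \<le> B0_const \<gamma> \<kappa> r \<sigma> varpi T"
    and "t \<in> {0..T} \<Longrightarrow> \<bar>ds h s t\<bar> \<le> B1_const \<gamma> \<sigma> varpi T"
    and "t \<in> {0..T} \<Longrightarrow> ((\<lambda>x. h x t) has_real_derivative ds h s t) (at s)"
proof -
  show "((\<lambda>x. h x t) has_real_derivative ds h s t) (at s)" if "t \<in> {0..T}"
  proof -
    have "(\<lambda>x. h x t) differentiable (at s)" using assms that by (auto simp: fk_space_def)
    then show ?thesis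
      unfolding ds_def by (auto simp: real_differentiable_def dest: DERIV_imp_deriv)
  qed
qed (use assms in \<open>auto simp: fk_space_def\<close>)

lemma Psi_continuous:
  assumes "0 < \<gamma>" "\<gamma> < 1" "0 < \<kappa>" "0 < \<sigma>" "r \<le> \<kappa>" "0 < kappa1 \<kappa> r"
    and h: "h \<in> fk_space \<gamma> \<kappa> r \<sigma> varpi T"
  shows "continuous_on (UNIV \<times> {0..T}) (\<lambda>(s, t). Psi \<gamma> \<kappa> r \<sigma> varpi T h s t)"
proof -
  have g: "continuous_on (UNIV \<times> {0..T}) (\<lambda>p. g_fun \<gamma> \<kappa> r \<sigma> T (snd p))"
    by (rule continuous_on_compose2[OF continuous_on_g_fun[OF assms(1-6)]])
      (auto intro!: continuous_intros)
  have h': "continuous_on (UNIV \<times> {0..T}) (\<lambda>p. h (fst p) (snd p))"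
    "continuous_on (UNIV \<times> {0..T}) (\<lambda>p. ds h (fst p) (snd p))"
    using fk_spaceD(1,2)[OF h] by (simp_all add: case_prod_beta)
  show ?thesis
    unfolding Psi_def G_fun_def case_prod_beta using assms
    by (intro continuous_intros g h') auto
qed

lemma Psi_bounded:
  assumes "0 < \<gamma>" "\<gamma> < 1" "0 < \<kappa>" "0 < \<sigma>" "r \<le> \<kappa>" "0 < kappa1 \<kappa> r"
    and h: "h \<in> fk_space \<gamma> \<kappa> r \<sigma> varpi T"
  obtains B where "\<And>s t. t \<in> {0..T} \<Longrightarrow> \<bar>Psi \<gamma> \<kappa> r \<sigma> varpi T h s t\<bar> \<le> B"
proof -
  have "bounded (g_fun \<gamma> \<kappa> r \<sigma> T ` {0..T})"
    by (intro compact_imp_bounded compact_continuous_image continuous_on_g_fun assms) simp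
  then obtain Bg where Bg: "\<And>t. t \<in> {0..T} \<Longrightarrow> \<bar>g_fun \<gamma> \<kappa> r \<sigma> T t\<bar> \<le> Bg"
    by (force simp: bounded_iff)
  let ?w = "(1 - \<gamma>) * varpi powr (- (1 / (1 - \<gamma>)))"
  have "\<bar>Psi \<gamma> \<kappa> r \<sigma> varpi T h s t\<bar>
      \<le> \<sigma>\<^sup>2 * (B1_const \<gamma> \<sigma> varpi T)\<^sup>2 / (2 * (1 - \<gamma>)) + \<sigma>\<^sup>2 * Bg / 2 + \<bar>r * \<gamma>\<bar> + ?w * 1"
    if t: "t \<in> {0..T}" for s t
    unfolding Psi_def
  proof (intro abs_triangle_ineq[THEN order_trans] add_mono)
    have "(ds h s t)\<^sup>2 \<le> (B1_const \<gamma> \<sigma> varpi T)\<^sup>2"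
      using fk_spaceD(5)[OF h t] by (metis abs_ge_zero power2_abs power_mono)
    then show "\<bar>\<sigma>\<^sup>2 * (ds h s t)\<^sup>2 / (2 * (1 - \<gamma>))\<bar> \<le> \<sigma>\<^sup>2 * (B1_const \<gamma> \<sigma> varpi T)\<^sup>2 / (2 * (1 - \<gamma>))"
      using assms by (simp add: abs_mult divide_right_mono mult_left_mono)
    show "\<bar>\<sigma>\<^sup>2 * g_fun \<gamma> \<kappa> r \<sigma> T t / 2\<bar> \<le> \<sigma>\<^sup>2 * Bg / 2"
      using Bg[OF t] by (simp add: abs_mult mult_left_mono)
    have "G_fun \<gamma> \<kappa> r \<sigma> T s t (h s t) \<le> 1"
      using assms t g_fun_nonneg[OF assms(1-6), of t T] fk_spaceD(3)[OF h t, of s]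
      by (simp add: G_fun_def)
    moreover have "0 \<le> G_fun \<gamma> \<kappa> r \<sigma> T s t (h s t)" by (simp add: G_fun_def)
    ultimately show "\<bar>?w * G_fun \<gamma> \<kappa> r \<sigma> T s t (h s t)\<bar> \<le> ?w * 1"
      unfolding abs_mult using assms by (intro mult_mono) auto
  qed simp
  then show ?thesis by (rule that)
qed

text \<open>
  The quadratic term is Lipschitz in the derivative only where the derivative is bounded, and the
  exponential only where its argument is bounded on one side.  Both bounds come from
  \<open>fk_space\<close> (together with \<open>g \<ge> 0\<close>), which makes the constant independent of \<open>h\<close> and \<open>k\<close>.
\<close>

lemma Psi_lipschitz:
  assumes "0 < \<gamma>" "\<gamma> < 1" "0 < \<kappa>" "0 < \<sigma>" "r \<le> \<kappa>" "0 < kappa1 \<kappa> r"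
    and h: "h \<in> fk_space \<gamma> \<kappa> r \<sigma> varpi T" and k: "k \<in> fk_space \<gamma> \<kappa> r \<sigma> varpi T"
    and t: "t \<in> {0..T}"
  shows "\<bar>Psi \<gamma> \<kappa> r \<sigma> varpi T h s t - Psi \<gamma> \<kappa> r \<sigma> varpi T k s t\<bar>
    \<le> (\<sigma>\<^sup>2 * B1_const \<gamma> \<sigma> varpi T / (1 - \<gamma>) + varpi powr (- (1 / (1 - \<gamma>)))) *
      (\<bar>h s t - k s t\<bar> + \<bar>ds h s t - ds k s t\<bar>)"
proof -
  let ?B = "B1_const \<gamma> \<sigma> varpi T" and ?w = "varpi powr (- (1 / (1 - \<gamma>)))"
  let ?G = "\<lambda>h. G_fun \<gamma> \<kappa> r \<sigma> T s t (h s t)"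
  have B: "0 \<le> ?B" using fk_spaceD(5)[OF h t, of s] by linarith
  have g: "0 \<le> g_fun \<gamma> \<kappa> r \<sigma> T t"
    using g_fun_nonneg[OF assms(1-6), of t T] t by simp
  have "(ds h s t)\<^sup>2 - (ds k s t)\<^sup>2 = (ds h s t + ds k s t) * (ds h s t - ds k s t)"
    by (simp add: power2_eq_square algebra_simps)
  also have "\<bar>\<dots>\<bar> \<le> (2 * ?B) * \<bar>ds h s t - ds k s t\<bar>"
    unfolding abs_mult using fk_spaceD(5)[OF h t, of s] fk_spaceD(5)[OF k t, of s]
    by (intro mult_right_mono) auto
  finally have 1: "\<sigma>\<^sup>2 / (2 * (1 - \<gamma>)) * \<bar>(ds h s t)\<^sup>2 - (ds k s t)\<^sup>2\<bar>
      \<le> \<sigma>\<^sup>2 / (2 * (1 - \<gamma>)) * ((2 * ?B) * \<bar>ds h s t - ds k s t\<bar>)"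
    using assms by (intro mult_left_mono) auto
  have "\<bar>?G h - ?G k\<bar> \<le> \<bar>1 / (1 - \<gamma>) * (s\<^sup>2 / 2 * g_fun \<gamma> \<kappa> r \<sigma> T t + h s t)
      - 1 / (1 - \<gamma>) * (s\<^sup>2 / 2 * g_fun \<gamma> \<kappa> r \<sigma> T t + k s t)\<bar>"
    unfolding G_fun_def mult_minus_left using assms g fk_spaceD(3)[OF h t, of s] fk_spaceD(3)[OF k t, of s]
    by (intro exp_minus_lipschitz mult_nonneg_nonneg add_nonneg_nonneg) auto
  also have "\<dots> = 1 / (1 - \<gamma>) * \<bar>h s t - k s t\<bar>"
    using assms by (simp add: diff_divide_distrib[symmetric] abs_mult)
  finally have 2: "(1 - \<gamma>) * ?w * \<bar>?G h - ?G k\<bar> \<le> (1 - \<gamma>) * ?w * (1 / (1 - \<gamma>) * \<bar>h s t - k s t\<bar>)"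
    using assms by (intro mult_left_mono) auto
  have "\<bar>Psi \<gamma> \<kappa> r \<sigma> varpi T h s t - Psi \<gamma> \<kappa> r \<sigma> varpi T k s t\<bar>
      = \<bar>\<sigma>\<^sup>2 / (2 * (1 - \<gamma>)) * ((ds h s t)\<^sup>2 - (ds k s t)\<^sup>2) + (1 - \<gamma>) * ?w * (?G h - ?G k)\<bar>"
    by (simp add: Psi_def algebra_simps diff_divide_distrib)
  also have "\<dots> \<le> \<sigma>\<^sup>2 / (2 * (1 - \<gamma>)) * \<bar>(ds h s t)\<^sup>2 - (ds k s t)\<^sup>2\<bar> + (1 - \<gamma>) * ?w * \<bar>?G h - ?G k\<bar>"
    using assms by (intro abs_triangle_ineq[THEN order_trans]) (simp add: abs_mult)
  also have "\<dots> \<le> \<sigma>\<^sup>2 * ?B / (1 - \<gamma>) * \<bar>ds h s t - ds k s t\<bar> + ?w * \<bar>h s t - k s t\<bar>"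
  proof -
    have e: "\<sigma>\<^sup>2 / (2 * (1 - \<gamma>)) * ((2 * ?B) * \<bar>ds h s t - ds k s t\<bar>) = \<sigma>\<^sup>2 * ?B / (1 - \<gamma>) * \<bar>ds h s t - ds k s t\<bar>"
      "(1 - \<gamma>) * ?w * (1 / (1 - \<gamma>) * \<bar>h s t - k s t\<bar>) = ?w * \<bar>h s t - k s t\<bar>"
      using assms by (simp_all add: field_simps)
    show ?thesis using 1 2 unfolding e by (rule add_mono)
  qed
  also have "\<dots> \<le> (\<sigma>\<^sup>2 * ?B / (1 - \<gamma>) + ?w) * (\<bar>h s t - k s t\<bar> + \<bar>ds h s t - ds k s t\<bar>)"
    using B assms by (simp add: distrib_left distrib_right)
  finally show ?thesis .
qed

section \<open>Iterating the mapping\<close>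

text \<open>
  A bound on the difference of two arguments is transported to their images
  with half a power of \<open>T - t\<close> more and a factor of order \<open>1 / sqrt (n + 1)\<close>.  The constant depends on
  neither the functions nor \<open>n\<close>, which is what permits iteration.  Membership
  of \<open>h'\<close> and \<open>k'\<close> in \<open>fk_space\<close> supplies the \<open>s\<close>-derivatives of the images, whose size is then read
  off from Lipschitz constants.
\<close>

lemma FK_map_gain:
  assumes "0 < \<gamma>" "\<gamma> < 1" "0 < \<kappa>" "0 < \<sigma>" "r \<le> \<kappa>" "0 < kappa1 \<kappa> r" and "0 < T"
    and BM: "brownian_motion M W"
    and flow: "linear_sde_flow M W (g1_fun \<gamma> \<kappa> r \<sigma> T) \<sigma> T \<eta>"
  obtains K where "0 < K" and "\<And>n \<beta> h k h' k' s t.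
      h \<in> fk_space \<gamma> \<kappa> r \<sigma> varpi T \<Longrightarrow> k \<in> fk_space \<gamma> \<kappa> r \<sigma> varpi T \<Longrightarrow>
      h' \<in> fk_space \<gamma> \<kappa> r \<sigma> varpi T \<Longrightarrow> k' \<in> fk_space \<gamma> \<kappa> r \<sigma> varpi T \<Longrightarrow>
      (\<And>s t. t \<in> {0..T} \<Longrightarrow> h' s t = FK_map \<gamma> \<kappa> r \<sigma> varpi T M \<eta> h s t) \<Longrightarrow>
      (\<And>s t. t \<in> {0..T} \<Longrightarrow> k' s t = FK_map \<gamma> \<kappa> r \<sigma> varpi T M \<eta> k s t) \<Longrightarrow>
      0 \<le> \<beta> \<Longrightarrow>
      (\<And>s t. t \<in> {0..T} \<Longrightarrow> \<bar>h s t - k s t\<bar> + \<bar>ds h s t - ds k s t\<bar> \<le> \<beta> * sqrt (T - t) ^ n) \<Longrightarrow>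
      t \<in> {0..T} \<Longrightarrow>
      \<bar>h' s t - k' s t\<bar> + \<bar>ds h' s t - ds k' s t\<bar> \<le> K / sqrt (real n + 1) * \<beta> * sqrt (T - t) ^ (n + 1)"
proof -
  let ?X = "fk_space \<gamma> \<kappa> r \<sigma> varpi T" and ?Psi = "Psi \<gamma> \<kappa> r \<sigma> varpi T"
    and ?FK = "FK_map \<gamma> \<kappa> r \<sigma> varpi T M \<eta>" and ?a = "g1_fun \<gamma> \<kappa> r \<sigma> T"
  have a_cont: "continuous_on {0..T} ?a"
    unfolding g1_fun_def by (intro continuous_intros continuous_on_g_fun assms)
  then have "bounded (?a ` {0..T})"
    by (intro compact_imp_bounded compact_continuous_image) auto
  then obtain A where A: "\<And>v. v \<in> {0..T} \<Longrightarrow> \<bar>?a v\<bar> \<le> A"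
    by (force simp: bounded_iff)
  define C where "C = 2 * exp (A * T) / \<sigma>"
  \<comment> \<open>The absolute value and the summand 1 only serve to make \<open>0 < L\<close> evident.\<close>
  define L where "L = \<sigma>\<^sup>2 * \<bar>B1_const \<gamma> \<sigma> varpi T\<bar> / (1 - \<gamma>) + varpi powr (- (1 / (1 - \<gamma>))) + 1"
  have pos: "0 < C" "0 < L" "0 < sqrt T"
    using assms by (auto simp: C_def L_def intro!: add_nonneg_pos)
  define K where "K = 4 * (sqrt T + C) * L"
  have "0 < K" using pos unfolding K_def by (intro mult_pos_pos add_pos_pos) auto
  then show ?thesis
  proof (rule that)
    fix n :: nat and \<beta> h k h' k' s t
    assume X: "h \<in> ?X" "k \<in> ?X" "h' \<in> ?X" "k' \<in> ?X"
      and h': "\<And>s t. t \<in> {0..T} \<Longrightarrow> h' s t = ?FK h s t"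
      and k': "\<And>s t. t \<in> {0..T} \<Longrightarrow> k' s t = ?FK k s t"
      and \<beta>: "0 \<le> \<beta>"
        "\<And>s t. t \<in> {0..T} \<Longrightarrow> \<bar>h s t - k s t\<bar> + \<bar>ds h s t - ds k s t\<bar> \<le> \<beta> * sqrt (T - t) ^ n"
      and t: "t \<in> {0..T}"
    define F where "F z u = ?Psi h z u - ?Psi k z u" for z u
    have F_cont: "continuous_on (UNIV \<times> {0..T}) (\<lambda>(s, t). F s t)"
      unfolding F_def case_prod_beta
      using Psi_continuous[OF assms(1-6) X(1)] Psi_continuous[OF assms(1-6) X(2)]
      by (intro continuous_on_diff) (simp_all add: case_prod_beta)
    have F_le: "\<bar>F z u\<bar> \<le> L * \<beta> * sqrt (T - u) ^ n" if u: "u \<in> {0..T}" for z u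
    proof -
      have "\<bar>F z u\<bar> \<le> (\<sigma>\<^sup>2 * B1_const \<gamma> \<sigma> varpi T / (1 - \<gamma>) + varpi powr (- (1 / (1 - \<gamma>)))) *
          (\<bar>h z u - k z u\<bar> + \<bar>ds h z u - ds k z u\<bar>)"
        unfolding F_def by (rule Psi_lipschitz[OF assms(1-6) X(1,2) u])
      also have "\<dots> \<le> L * (\<beta> * sqrt (T - u) ^ n)"
      proof (rule mult_mono[OF _ \<beta>(2)[OF u]])
        have "\<sigma>\<^sup>2 * B1_const \<gamma> \<sigma> varpi T / (1 - \<gamma>) \<le> \<sigma>\<^sup>2 * \<bar>B1_const \<gamma> \<sigma> varpi T\<bar> / (1 - \<gamma>)"
          using assms by (intro divide_right_mono mult_left_mono) auto
        then show "\<sigma>\<^sup>2 * B1_const \<gamma> \<sigma> varpi T / (1 - \<gamma>) + varpi powr (- (1 / (1 - \<gamma>))) \<le> L"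
          by (simp add: L_def)
      qed (use pos in auto)
      finally show ?thesis by (simp add: mult.assoc)
    qed
    define V where "V s = integral {t..T} (\<lambda>u. prob_space.expectation M (\<lambda>x. F (\<eta> s t u x) u))" for s
    have diff: "h' z t - k' z t = V z" for z
    proof -
      interpret prob_space M using BM by (simp add: brownian_motion_def)
      obtain B1 B2 where B: "\<And>s t. t \<in> {0..T} \<Longrightarrow> \<bar>?Psi h s t\<bar> \<le> B1" "\<And>s t. t \<in> {0..T} \<Longrightarrow> \<bar>?Psi k s t\<bar> \<le> B2"
        using Psi_bounded[OF assms(1-6) X(1)] Psi_bounded[OF assms(1-6) X(2)] by metis
      note I = flow_integrable[OF BM flow Psi_continuous[OF assms(1-6) X(1)] B(1) t]
        flow_integrable[OF BM flow Psi_continuous[OF assms(1-6) X(2)] B(2) t]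
      note J = flow_expectation_continuous[OF BM flow Psi_continuous[OF assms(1-6) X(1)] B(1) t,
            THEN integrable_continuous_interval]
        flow_expectation_continuous[OF BM flow Psi_continuous[OF assms(1-6) X(2)] B(2) t,
            THEN integrable_continuous_interval]
      have "h' z t - k' z t = integral {t..T} (\<lambda>u.
          expectation (\<lambda>x. ?Psi h (\<eta> z t u x) u) - expectation (\<lambda>x. ?Psi k (\<eta> z t u x) u))"
        unfolding h'[OF t] k'[OF t] FK_map_def
        by (rule Henstock_Kurzweil_Integration.integral_diff[OF J, symmetric])
      also have "\<dots> = V z"
        unfolding V_def F_def
        by (intro integral_cong Bochner_Integration.integral_diff[symmetric] I)
      finally show ?thesis .
    qed
    define R where "R = sqrt (T - t) ^ (n + 1) / sqrt (real n + 1)"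
    have "0 \<le> L * \<beta>" using pos \<beta> by simp
    note V = flow_potential_abs_le[OF BM flow a_cont A \<open>0 < \<sigma>\<close> F_cont \<open>0 \<le> L * \<beta>\<close> F_le t, folded V_def]
      flow_potential_lipschitz[OF BM flow a_cont A \<open>0 < \<sigma>\<close> F_cont \<open>0 \<le> L * \<beta>\<close> F_le t, folded V_def C_def]
    have "\<bar>h' s t - k' s t\<bar> \<le> 4 * sqrt T * L * \<beta> * R"
      using V(1)[of s] by (simp add: diff R_def mult_ac)
    moreover have "\<bar>ds h' s t - ds k' s t\<bar> \<le> 4 * C * L * \<beta> * R"
    proof (rule has_real_derivative_abs_le)
      show "((\<lambda>z. h' z t - k' z t) has_real_derivative ds h' s t - ds k' s t) (at s)"
        by (intro DERIV_diff fk_spaceD(6)[OF X(3) t] fk_spaceD(6)[OF X(4) t])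
      show "\<bar>h' z t - k' z t - (h' s t - k' s t)\<bar> \<le> 4 * C * L * \<beta> * R * \<bar>z - s\<bar>" for z
        using V(2)[of z s] by (simp add: diff R_def mult_ac)
    qed
    ultimately have "\<bar>h' s t - k' s t\<bar> + \<bar>ds h' s t - ds k' s t\<bar> \<le> K * \<beta> * R"
      by (simp add: K_def distrib_left distrib_right)
    then show "\<bar>h' s t - k' s t\<bar> + \<bar>ds h' s t - ds k' s t\<bar>
        \<le> K / sqrt (real n + 1) * \<beta> * sqrt (T - t) ^ (n + 1)"
      by (simp add: R_def mult_ac)
  qed
qed

theorem theorem5p3:
  fixes \<gamma> \<kappa> r \<sigma> varpi T \<delta> :: real
    and M :: "'a measure" and W :: "real \<Rightarrow> 'a \<Rightarrow> real"
    and \<eta> :: "real \<Rightarrow> real \<Rightarrow> real \<Rightarrow> 'a \<Rightarrow> real"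
    and h :: "real \<Rightarrow> real \<Rightarrow> real" and hs :: "nat \<Rightarrow> real \<Rightarrow> real \<Rightarrow> real"
  assumes "0 < \<gamma>" "\<gamma> < 1" "0 < \<kappa>" "0 < \<sigma>" "0 < varpi" "r \<le> \<kappa>" "0 < kappa1 \<kappa> r"
    and "0 < T" "T < T0_const \<gamma> \<kappa> r \<sigma> T"
    and "brownian_motion M W"
    and "linear_sde_flow M W (g1_fun \<gamma> \<kappa> r \<sigma> T) \<sigma> T \<eta>"
    and "h \<in> fk_space \<gamma> \<kappa> r \<sigma> varpi T"
    and "\<And>s t. t \<in> {0..T} \<Longrightarrow> h s t = FK_map \<gamma> \<kappa> r \<sigma> varpi T M \<eta> h s t"
    and "\<And>n. hs n \<in> fk_space \<gamma> \<kappa> r \<sigma> varpi T"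
    and "\<And>s t. t \<in> {0..T} \<Longrightarrow> hs 0 s t = 0"
    and "\<And>n s t. t \<in> {0..T} \<Longrightarrow> hs (Suc n) s t = FK_map \<gamma> \<kappa> r \<sigma> varpi T M \<eta> (hs n) s t"
    and "0 < \<delta>" "\<delta> < 1 / 2"
  shows "(\<lambda>n. strip_norm T (\<lambda>s t. h s t - hs n s t)) \<in> O(\<lambda>n. real n powr (- \<delta> * real n))"
proof -
  note h = assms(12,13) and hs = assms(14,16)
  obtain K where K: "0 < K" and gain: "\<And>n \<beta> h k h' k' s t.
      h \<in> fk_space \<gamma> \<kappa> r \<sigma> varpi T \<Longrightarrow> k \<in> fk_space \<gamma> \<kappa> r \<sigma> varpi T \<Longrightarrow>
      h' \<in> fk_space \<gamma> \<kappa> r \<sigma> varpi T \<Longrightarrow> k' \<in> fk_space \<gamma> \<kappa> r \<sigma> varpi T \<Longrightarrow>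
      (\<And>s t. t \<in> {0..T} \<Longrightarrow> h' s t = FK_map \<gamma> \<kappa> r \<sigma> varpi T M \<eta> h s t) \<Longrightarrow>
      (\<And>s t. t \<in> {0..T} \<Longrightarrow> k' s t = FK_map \<gamma> \<kappa> r \<sigma> varpi T M \<eta> k s t) \<Longrightarrow>
      0 \<le> \<beta> \<Longrightarrow>
      (\<And>s t. t \<in> {0..T} \<Longrightarrow> \<bar>h s t - k s t\<bar> + \<bar>ds h s t - ds k s t\<bar> \<le> \<beta> * sqrt (T - t) ^ n) \<Longrightarrow>
      t \<in> {0..T} \<Longrightarrow>
      \<bar>h' s t - k' s t\<bar> + \<bar>ds h' s t - ds k' s t\<bar> \<le> K / sqrt (real n + 1) * \<beta> * sqrt (T - t) ^ (n + 1)"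
    using FK_map_gain[OF assms(1-4,6-8,10,11), of varpi] by blast
  \<comment> \<open>The factor 2 arises because \<open>ds (hs 0)\<close> is estimated by \<open>B1\<close>, just as \<open>ds h\<close> is.\<close>
  define b where "b = B0_const \<gamma> \<kappa> r \<sigma> varpi T + 2 * B1_const \<gamma> \<sigma> varpi T"
  have bound: "\<bar>h s t - hs n s t\<bar> + \<bar>ds h s t - ds (hs n) s t\<bar> \<le> b * K ^ n / sqrt (fact n) * sqrt (T - t) ^ n"
    if "t \<in> {0..T}" for n s t
    using that
  proof (induction n arbitrary: s t)
    case 0
    show ?case
      using fk_spaceD(3,4,5)[OF h(1) 0, of s] fk_spaceD(5)[OF hs(1) 0, of 0 s] assms(15)[OF 0, of s]
      by (simp add: b_def)
  next
    case (Suc n)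
    have "0 \<le> b"
      using fk_spaceD(3,4,5)[OF h(1) Suc.prems, of s] by (simp add: b_def)
    then have "\<bar>h s t - hs (Suc n) s t\<bar> + \<bar>ds h s t - ds (hs (Suc n)) s t\<bar>
        \<le> K / sqrt (real n + 1) * (b * K ^ n / sqrt (fact n)) * sqrt (T - t) ^ (n + 1)"
      by (intro gain[OF h(1) hs(1) h(1) hs(1) h(2) hs(2)] Suc.IH Suc.prems) (use K in auto)
    also have "\<dots> = b * K ^ Suc n / sqrt (fact (Suc n)) * sqrt (T - t) ^ Suc n"
      by (simp add: real_sqrt_mult add.commute)
    finally show ?case .
  qed
  have "(\<lambda>n. strip_norm T (\<lambda>s t. h s t - hs n s t)) \<in> O(\<lambda>n. (K * sqrt T) ^ n / sqrt (fact n))"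
  proof (intro bigoI[of _ b] always_eventually allI)
    fix n
    define c where "c = b * ((K * sqrt T) ^ n / sqrt (fact n))"
    define f where "f = (\<lambda>s t. h s t - hs n s t)"
    have ds_f: "ds f s t = ds h s t - ds (hs n) s t" if "t \<in> {0..T}" for s t
      unfolding f_def ds_def[of "\<lambda>s t. h s t - hs n s t"]
      by (intro DERIV_imp_deriv DERIV_diff fk_spaceD(6)[OF h(1) that] fk_spaceD(6)[OF hs(1) that])
    have "0 \<le> b"
      using fk_spaceD(3,4,5)[OF h(1), of 0 0] \<open>0 < T\<close> by (simp add: b_def)
    have le: "\<bar>f s t\<bar> + \<bar>ds f s t\<bar> \<le> c" if t: "t \<in> {0..T}" for s t
    proof -
      have "\<bar>f s t\<bar> + \<bar>ds f s t\<bar> \<le> b * K ^ n / sqrt (fact n) * sqrt (T - t) ^ n"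
        using bound[OF t, of s n] by (simp only: ds_f[OF t]) (simp add: f_def)
      also have "\<dots> \<le> b * K ^ n / sqrt (fact n) * sqrt T ^ n"
        using t K \<open>0 \<le> b\<close> by (intro mult_left_mono power_mono) auto
      finally show ?thesis by (simp add: c_def power_mult_distrib)
    qed
    have "strip_norm T f \<le> c"
      unfolding strip_norm_def using \<open>0 < T\<close> le by (intro cSUP_least) auto
    moreover have "0 \<le> strip_norm T f"
    proof -
      have "\<bar>f 0 0\<bar> + \<bar>ds f 0 0\<bar> \<le> strip_norm T f"
        unfolding strip_norm_def using \<open>0 < T\<close> le
        by (intro cSUP_upper2[of _ _ "(0, 0)"] bdd_aboveI2[of _ _ c]) auto
      then show ?thesis by linarith
    qed
    ultimately show "norm (strip_norm T (\<lambda>s t. h s t - hs n s t)) \<le> b * norm ((K * sqrt T) ^ n / sqrt (fact n))"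
      using K \<open>0 < T\<close> by (simp add: c_def f_def)
  qed
  also have "(\<lambda>n. (K * sqrt T) ^ n / sqrt (fact n)) \<in> O(\<lambda>n. real n powr (- \<delta> * real n))"
    using K \<open>0 < T\<close> \<open>\<delta> < 1 / 2\<close> by (intro power_over_sqrt_fact_bigo) auto
  finally show ?thesis .
qed

end
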